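(* Let $d=1$, let $R=\{\pm\sqrt2\}$ (so that $W=\{\pm \mathrm{id}_{\mathbb{R}}\}$), and let $k\geq 0$ denote the constant value of the multiplicity function, with $\lambda=k-\frac12>0$. For every open set $U\subset\mathbb{R}$ that is not symmetric (i.e. $-U\neq U$) there exists a Borel function $h:\mathbb{R}\to\mathbb{R}$ which is $\Delta_k$-harmonic on $U$ but does not satisfy the mean value property on $U$; that is, $h$ is $C^2$ on $U$ with $\Delta_kh=0$ on $U$, and it is not the case that $\int_{\mathbb{R}}h(y)\,d\sigma_{x,r}^k(y)=h(x)$ for all $x\in U$ and all $r>0$ with $[x-r,x+r]\subset U$.
   Context: Setting (one-dimensional Dunkl theory for the root system $\{\pm\sqrt2\}$, positive subsystem $R_+=\{\sqrt2\}$, the reflection being $x\mapsto-x$). The Dunkl operator is $Tf(x)=f'(x)+k\,\frac{f(x)-f(-x)}{x}$, and the Dunkl Laplacian is $\Delta_k=T^2$, explicitly $$\Delta_kf(x)=f''(x)+\frac{2k}{x}f'(x)-k\,\frac{f(x)-f(-x)}{x^2},$$ understood by continuous extension at $x=0$. For a function $h:\mathbb{R}\to\mathbb{R}$ that is $C^2$ on an open set $U$ (not necessarily symmetric), $\Delta_kh(x)$, $x\in U$, is given by this formula, using the values of $h$ on all of $\mathbb{R}$. The weight function is $w_k(x)=|\sqrt2\,x|^{2k}$; here $\gamma=k$ and $\lambda=\gamma+\frac12-1=k-\frac12$. Intertwining operator and translation. There is a unique linear map $V_k$ on polynomials that restricts to an isomorphism of the space of homogeneous polynomials of each degree $n$ onto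 itself and satisfies $V_k1=1$ and $TV_kp=V_kp'$ for every polynomial $p$; it extends to a homeomorphism of $C^\infty(\mathbb{R})$, and there are probability measures $\mu_x^k$, $x\in\mathbb{R}$, supported in $[-|x|,|x|]$, with $V_kf(x)=\int f\,d\mu_x^k$ for all $f\in C^\infty(\mathbb{R})$. The Dunkl translation of $f\in C^\infty(\mathbb{R})$ is $\tau_xf(y)=\int\int V_k^{-1}f(z+\eta)\,d\mu_x^k(z)\,d\mu_y^k(\eta)$. The measures $\sigma_{x,r}^k$. Let $d_k=w_k(1)+w_k(-1)$. For $x\in\mathbb{R}$ and $r>0$, $\sigma_{x,r}^k$ is the unique (known to exist) probability measure on $\mathbb{R}$, supported in $\big([x-r,x+r]\cup[-x-r,-x+r]\big)\setminus\,]-||x|-r|,\,||x|-r|[$, such that for all $f\in C^\infty(\mathbb{R})$, $$\frac1{d_k}\big(\tau_xf(r)w_k(1)+\tau_xf(-r)w_k(-1)\big)=\int_{\mathbb{R}}f(y)\,d\sigma_{x,r}^k(y).$$ *)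

theory Defs
  imports "HOL-Probability.Probability" "HOL-Computational_Algebra.Polynomial"
begin

text \<open>
  Rank-one Dunkl theory on \<open>\<real>\<close>, with real multiplicity \<open>k\<close>. At the origin the Dunkl operator
  and the Dunkl Laplacian are defined by continuous extension, i.e. as limits.
\<close>

definition dunkl_op :: "real \<Rightarrow> (real \<Rightarrow> real) \<Rightarrow> real \<Rightarrow> real" where
  "dunkl_op k f x =
     (let D = (\<lambda>y. deriv f y + k * ((f y - f (- y)) / y))
      in if x = 0 then Lim (at 0) D else D x)"

definition dunkl_laplacian :: "real \<Rightarrow> (real \<Rightarrow> real) \<Rightarrow> real \<Rightarrow> real" where
  "dunkl_laplacian k f x =
     (let L = (\<lambda>y. deriv (deriv f) y + (2 * k / y) * deriv f y - k * ((f y - f (- y)) / y\<^sup>2))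
      in if x = 0 then Lim (at 0) L else L x)"

definition C2_on :: "(real \<Rightarrow> real) \<Rightarrow> real set \<Rightarrow> bool" where
  "C2_on f U \<longleftrightarrow>
     (\<forall>x\<in>U. f field_differentiable at x) \<and>
     (\<forall>x\<in>U. deriv f field_differentiable at x) \<and>
     continuous_on U (deriv (deriv f))"

text \<open>For \<open>x \<in> U\<close> with \<open>- x \<notin> U\<close> the reflection term uses the value of \<open>h\<close> outside \<open>U\<close>.\<close>

definition dunkl_harmonic_on :: "real \<Rightarrow> (real \<Rightarrow> real) \<Rightarrow> real set \<Rightarrow> bool" where
  "dunkl_harmonic_on k h U \<longleftrightarrow> C2_on h U \<and> (\<forall>x\<in>U. dunkl_laplacian k h x = 0)"

definition dunkl_weight :: "real \<Rightarrow> real \<Rightarrow> real" where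
  "dunkl_weight k x = \<bar>sqrt 2 * x\<bar> powr (2 * k)"

definition smooth_functions :: "(real \<Rightarrow> real) set" where
  "smooth_functions = {f. \<forall>n x. ((deriv ^^ n) f) field_differentiable at x}"

text \<open>
  The Frechet topology of \<open>C\<^sup>\<infinity>(\<real>)\<close>: uniform convergence of all derivatives on compact sets,
  generated by the balls of the seminorms \<open>f \<mapsto> sup\<^sub>K \<bar>f\<^sup>(\<^sup>n\<^sup>)\<bar>\<close>. (The supremum over the compact
  set \<open>K\<close> is attained, so it is \<open>< e\<close> iff the strict bound holds pointwise on \<open>K\<close>.)
  Its underlying set is \<open>smooth_functions\<close>.
\<close>

definition smooth_topology :: "(real \<Rightarrow> real) topology" where
  "smooth_topology = topology_generated_by
     {{g \<in> smooth_functions. \<forall>x\<in>K. \<bar>(deriv ^^ n) g x - (deriv ^^ n) f x\<bar> < e} | f K n e.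
        f \<in> smooth_functions \<and> compact K \<and> 0 < e}"

definition homogeneous_polys :: "nat \<Rightarrow> (real \<Rightarrow> real) set" where
  "homogeneous_polys n = {\<lambda>x. c * x ^ n | c. True}"

text \<open>
  The intertwining operator, as a linear homeomorphism of \<open>C\<^sup>\<infinity>(\<real>)\<close> whose restriction to polynomials
  has the characterizing properties. Polynomials being dense, these determine the operator on
  \<open>C\<^sup>\<infinity>(\<real>)\<close>; its values on functions that are not smooth are irrelevant.
\<close>

definition intertwining_operator :: "real \<Rightarrow> ((real \<Rightarrow> real) \<Rightarrow> (real \<Rightarrow> real)) \<Rightarrow> bool" where
  "intertwining_operator k V \<longleftrightarrow>
     (\<forall>f\<in>smooth_functions. \<forall>g\<in>smooth_functions. \<forall>a b.
        V (\<lambda>x. a * f x + b * g x) = (\<lambda>x. a * V f x + b * V g x)) \<and>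
     (\<forall>n. bij_betw V (homogeneous_polys n) (homogeneous_polys n)) \<and>
     V (\<lambda>x. 1) = (\<lambda>x. 1) \<and>
     (\<forall>p. dunkl_op k (V (poly p)) = V (poly (pderiv p))) \<and>
     homeomorphic_map smooth_topology smooth_topology V"

definition borel_probability_supported_in :: "real measure \<Rightarrow> real set \<Rightarrow> bool" where
  "borel_probability_supported_in M S \<longleftrightarrow>
     prob_space M \<and> sets M = sets borel \<and> emeasure M (- S) = 0"

definition representing_measures ::
  "((real \<Rightarrow> real) \<Rightarrow> (real \<Rightarrow> real)) \<Rightarrow> (real \<Rightarrow> real measure) \<Rightarrow> bool" where
  "representing_measures V \<mu> \<longleftrightarrow>
     (\<forall>x. borel_probability_supported_in (\<mu> x) {- \<bar>x\<bar>..\<bar>x\<bar>} \<and>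
          (\<forall>f\<in>smooth_functions. V f x = (LINT t|\<mu> x. f t)))"

definition dunkl_translation ::
  "((real \<Rightarrow> real) \<Rightarrow> (real \<Rightarrow> real)) \<Rightarrow> (real \<Rightarrow> real measure) \<Rightarrow>
   real \<Rightarrow> (real \<Rightarrow> real) \<Rightarrow> real \<Rightarrow> real" where
  "dunkl_translation V \<mu> x f y =
     (LINT \<eta>|\<mu> y. (LINT z|\<mu> x. inv_into smooth_functions V f (z + \<eta>)))"

definition dunkl_sphere_measure ::
  "real \<Rightarrow> ((real \<Rightarrow> real) \<Rightarrow> (real \<Rightarrow> real)) \<Rightarrow> (real \<Rightarrow> real measure) \<Rightarrow>
   real \<Rightarrow> real \<Rightarrow> real measure \<Rightarrow> bool" where
  "dunkl_sphere_measure k V \<mu> x r M \<longleftrightarrow>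
     borel_probability_supported_in M
       (({x - r..x + r} \<union> {- x - r..- x + r}) - {- \<bar>\<bar>x\<bar> - r\<bar><..<\<bar>\<bar>x\<bar> - r\<bar>}) \<and>
     (\<forall>f\<in>smooth_functions.
        (1 / (dunkl_weight k 1 + dunkl_weight k (- 1))) *
          (dunkl_translation V \<mu> x f r * dunkl_weight k 1 +
           dunkl_translation V \<mu> x f (- r) * dunkl_weight k (- 1))
        = (LINT y|M. f y))"

definition mean_value_property_on ::
  "(real \<Rightarrow> real \<Rightarrow> real measure) \<Rightarrow> (real \<Rightarrow> real) \<Rightarrow> real set \<Rightarrow> bool" where
  "mean_value_property_on \<sigma> h U \<longleftrightarrow>
     (\<forall>x\<in>U. \<forall>r>0. {x - r..x + r} \<subseteq> U \<longrightarrow> (LINT y|\<sigma> x r. h y) = h x)"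

end

theory Submission
  imports Defs
begin

text \<open>
  Let \<open>c \<in> U\<close> with \<open>-c \<notin> U\<close>, and rescale (with a reflection if \<open>c < 0\<close>) to \<open>c = 1\<close>. There is a continuous function, called \<open>kink\<close>, that
  vanishes on \<open>[-1, 1]\<close> and solves the Dunkl-Laplace equation everywhere except at \<open>-1\<close>: beyond \<open>\<plusminus>1\<close> it
  is the harmonic function with a triple zero at \<open>1\<close>, so it is twice continuously differentiable at \<open>1\<close> but
  has a concave kink at \<open>-1\<close>. As \<open>-1\<close> is not in \<open>U\<close>, it is harmonic on \<open>U\<close> (\<open>dunkl_harmonic_kink\<close>). This single
  function works for every non-symmetric \<open>U\<close>, however small the complement of \<open>U\<close> is near \<open>-1\<close>.

  The mean value property fails because the spherical measure at a point near \<open>1\<close> puts some mass near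
  \<open>-1\<close>, where it meets the kink. Its mass on the reflected interval is of order \<open>\<rho>\<^sup>2\<close> for radius \<open>\<rho>\<close>, and the function
  is of order \<open>-\<rho>\<close> there. On the direct interval the mass is of order \<open>1\<close> and the function of order \<open>\<rho>\<^sup>3\<close>. Both contributions
  to the mean are thus of order \<open>\<rho>\<^sup>3\<close>, and a rough estimate of the reflected mass is not sufficient. The
  centre is therefore chosen slightly below \<open>1\<close>, such that only a small tip of the interval reaches beyond \<open>1\<close>. On
  a small tip the linear zero beats the cubic one, the mean is negative
  (\<open>reflected_mean_kink_negative\<close>), and the value at the centre is \<open>0\<close>.

  This comparison needs the spherical measures explicitly. Under \<open>\<sigma>\<close> at centre \<open>x\<close> and radius \<open>r < \<bar>x\<bar>\<close>, the
  absolute value of \<open>y\<close> is \<open>z = sqrt (x\<^sup>2 + r\<^sup>2 + 2 \<bar>x\<bar> r cos \<theta>)\<close> with an angle of density proportional to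
  \<open>sin\<^sup>2\<^sup>k\<^sup>-\<^sup>1 \<theta>\<close>, and given \<open>\<theta>\<close> the sign of \<open>y\<close> has mean \<open>(z\<^sup>2 + x\<^sup>2 - r\<^sup>2) / (2 x z)\<close>
  (\<open>dunkl_sphere_integral\<close>). To prove this it suffices to compare moments. The relation \<open>T V = V (d/dx)\<close> determines \<open>V\<close> on
  monomials, which gives the moments of \<open>\<sigma>\<close> in closed form; the even ones satisfy the same three-term
  recurrence as the moments of \<open>z\<^sup>2\<close>, where it comes from integration by parts, and the odd ones are
  combinations of even ones in the same way on both sides.
\<close>

section \<open>The intertwining operator on monomials\<close>

text \<open>
  The Dunkl operator sends \<open>x\<^sup>n\<close> to \<open>(n + k (1 - (-1)\<^sup>n)) x\<^sup>n\<^sup>-\<^sup>1\<close>. The product of these factors takes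
  over the role that \<open>n!\<close> has for the ordinary derivative.
\<close>

primrec dunkl_fact :: "real \<Rightarrow> nat \<Rightarrow> real" where
  "dunkl_fact k 0 = 1"
| "dunkl_fact k (Suc n) = (real (Suc n) + k * (1 - (- 1) ^ Suc n)) * dunkl_fact k n"

lemma dunkl_fact_pos:
  assumes "k \<ge> 0"
  shows "dunkl_fact k n > 0"
proof (induction n)
  case (Suc n)
  have "k * (1 - (- 1) ^ Suc n) \<ge> 0"
    using assms by (cases "even n") auto
  then have "real (Suc n) + k * (1 - (- 1) ^ Suc n) > 0"
    by linarith
  then show ?case
    using Suc by simp
qed simp

lemma poly_smooth: "poly p \<in> smooth_functions"
proof -
  have "(deriv ^^ n) (poly p) = poly ((pderiv ^^ n) p)" for n
    by (induction n) (auto intro!: DERIV_imp_deriv poly_DERIV)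
  then show ?thesis
    by (auto simp: smooth_functions_def field_differentiable_def intro: poly_DERIV)
qed

lemma monomial_smooth: "(\<lambda>x. c * x ^ n) \<in> smooth_functions"
  using poly_smooth[of "monom c n"] by (simp add: poly_monom[abs_def])

lemma dunkl_op_monomial_at_1:
  "dunkl_op k (\<lambda>x. c * x ^ n) 1 = c * (real n + k * (1 - (- 1) ^ n))"
proof -
  have "deriv (\<lambda>x. c * x ^ n) (1::real) = c * real n"
    by (rule DERIV_imp_deriv) (auto intro!: derivative_eq_intros)
  then show ?thesis
    by (simp add: dunkl_op_def algebra_simps)
qed

lemma intertwining_scale:
  assumes "intertwining_operator k V" and "f \<in> smooth_functions"
  shows "V (\<lambda>x. a * f x) = (\<lambda>x. a * V f x)"
proof -
  have "V (\<lambda>x. a * f x + 0 * f x) = (\<lambda>x. a * V f x + 0 * V f x)"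
    using assms unfolding intertwining_operator_def by blast
  then show ?thesis by simp
qed

text \<open>
  Since \<open>V\<close> preserves the degree, \<open>V x\<^sup>n = c\<^sub>n x\<^sup>n\<close>. Comparing both sides of \<open>T V = V (d/dx)\<close> on \<open>x\<^sup>n\<^sup>+\<^sup>1\<close>
  gives a first-order recursion for \<open>c\<^sub>n\<close>; it can be read off at the point \<open>1\<close>.
\<close>

lemma intertwining_monomial:
  assumes "k \<ge> 0" and V: "intertwining_operator k V"
  shows "V (\<lambda>x. x ^ n) = (\<lambda>x. fact n / dunkl_fact k n * x ^ n)"
proof (induction n)
  case 0
  then show ?case using V by (simp add: intertwining_operator_def)
next
  case (Suc n)
  have "(\<lambda>x. 1 * x ^ Suc n) \<in> homogeneous_polys (Suc n)"
    unfolding homogeneous_polys_def by blast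
  moreover have "V ` homogeneous_polys (Suc n) = homogeneous_polys (Suc n)"
    using V unfolding intertwining_operator_def bij_betw_def by blast
  ultimately have "V (\<lambda>x. 1 * x ^ Suc n) \<in> homogeneous_polys (Suc n)"
    by blast
  then obtain c where c: "V (\<lambda>x. x ^ Suc n) = (\<lambda>x. c * x ^ Suc n)"
    unfolding homogeneous_polys_def by auto
  have "dunkl_op k (V (poly (monom 1 (Suc n)))) = V (poly (pderiv (monom 1 (Suc n))))"
    using V unfolding intertwining_operator_def by blast
  then have "dunkl_op k (\<lambda>x. c * x ^ Suc n) = V (\<lambda>x. real (Suc n) * x ^ n)"
    using c by (simp add: poly_monom[abs_def] pderiv_monom del: power_Suc)
  also have "\<dots> = (\<lambda>x. real (Suc n) * V (\<lambda>x. x ^ n) x)"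
    using monomial_smooth[of 1 n] by (intro intertwining_scale[OF V]) simp
  finally have "c * (real (Suc n) + k * (1 - (- 1) ^ Suc n))
      = real (Suc n) * (fact n / dunkl_fact k n)"
    using dunkl_op_monomial_at_1[of k c "Suc n"] by (simp add: Suc)
  moreover have "dunkl_fact k (Suc n) > 0" "dunkl_fact k n > 0"
    using dunkl_fact_pos[OF assms(1)] by blast+
  ultimately have "c = fact (Suc n) / dunkl_fact k (Suc n)"
    by (auto simp: divide_simps mult_ac)
  then show ?case using c by simp
qed

text \<open>
  Injectivity of \<open>V\<close> on smooth functions, contained in the homeomorphism property, makes
  \<open>inv_into\<close> a genuine inverse.
\<close>

lemma inv_intertwining_monomial:
  assumes "k \<ge> 0" and V: "intertwining_operator k V"
  shows "inv_into smooth_functions V (\<lambda>x. x ^ n) = (\<lambda>x. dunkl_fact k n / fact n * x ^ n)"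
proof -
  have "topspace smooth_topology = smooth_functions"
  proof
    show "smooth_functions \<subseteq> topspace smooth_topology"
    proof
      fix g assume g: "g \<in> smooth_functions"
      then have "g \<in> {h \<in> smooth_functions. \<forall>x\<in>{}. \<bar>(deriv ^^ 0) h x - (deriv ^^ 0) g x\<bar> < 1}"
        by simp
      moreover have "compact ({} :: real set)" "(0::real) < 1"
        by auto
      ultimately show "g \<in> topspace smooth_topology"
        unfolding smooth_topology_def topology_generated_by_topspace using g by blast
    qed
  qed (auto simp: smooth_topology_def topology_generated_by_topspace)
  then have inj: "inj_on V smooth_functions"
    using V unfolding intertwining_operator_def homeomorphic_eq_everything_map by auto
  have m: "(\<lambda>x. x ^ n) \<in> smooth_functions" for n
    using monomial_smooth[of 1 n] by simp
  have "dunkl_fact k n > 0"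
    using dunkl_fact_pos[OF assms(1)] .
  then have "V (\<lambda>x. dunkl_fact k n / fact n * x ^ n) = (\<lambda>x. x ^ n)"
    using intertwining_scale[OF V m, of "dunkl_fact k n / fact n" n]
      intertwining_monomial[OF assms, of n] by (simp add: fun_eq_iff)
  then show ?thesis
    using inv_into_f_f[OF inj monomial_smooth] by metis
qed

section \<open>Moments of the spherical measures\<close>

lemma AE_compact_support:
  assumes "borel_probability_supported_in M S" and "S \<in> sets borel" and "S \<subseteq> {-B..B}"
  shows "AE y in M. y \<in> {-B..B}"
proof -
  have sets: "sets M = sets borel" and 0: "emeasure M (- S) = 0"
    using assms(1) by (auto simp: borel_probability_supported_in_def)
  then have "- S \<in> null_sets M"
    using assms(2) by (auto simp: null_sets_def)
  then show ?thesis
    by (rule AE_I') (use assms(3) in auto)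
qed

lemma integrable_continuous_compact_support:
  fixes f :: "real \<Rightarrow> real"
  assumes "borel_probability_supported_in M S" and "S \<in> sets borel" and "S \<subseteq> {-B..B}"
    and "continuous_on UNIV f"
  shows "integrable M f"
proof -
  interpret prob_space M
    using assms(1) by (simp add: borel_probability_supported_in_def)
  have sets: "sets M = sets borel"
    using assms(1) by (auto simp: borel_probability_supported_in_def)
  have "bounded (f ` {-B..B})"
    by (intro compact_imp_bounded compact_continuous_image continuous_on_subset[OF assms(4)]) auto
  then obtain C where C: "\<And>y. y \<in> {-B..B} \<Longrightarrow> norm (f y) \<le> C"
    unfolding bounded_iff by blast
  have "f \<in> borel_measurable M"
    using borel_measurable_continuous_onI[OF assms(4)] sets measurable_cong_sets by blast
  moreover have "AE y in M. norm (f y) \<le> C"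
    using AE_compact_support[OF assms(1-3)] C by auto
  ultimately show ?thesis
    by (intro integrable_const_bound)
qed

lemma integrable_representing:
  fixes f :: "real \<Rightarrow> real"
  assumes "representing_measures V \<mu>" and "continuous_on UNIV f"
  shows "integrable (\<mu> x) f"
  by (rule integrable_continuous_compact_support[where S = "{- \<bar>x\<bar>..\<bar>x\<bar>}" and B = "\<bar>x\<bar>"])
    (use assms in \<open>auto simp: representing_measures_def\<close>)

lemma representing_moment:
  assumes "k \<ge> 0" and "intertwining_operator k V" and "representing_measures V \<mu>"
  shows "(LINT t|\<mu> x. t ^ n) = fact n / dunkl_fact k n * x ^ n"
proof -
  have "V (\<lambda>x. x ^ n) x = (LINT t|\<mu> x. t ^ n)"
    using assms(3) monomial_smooth[of 1 n] by (simp add: representing_measures_def)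
  then show ?thesis
    using intertwining_monomial[OF assms(1,2)] by simp
qed

text \<open>
  A binomial theorem: expand \<open>(z + \<eta>)\<^sup>n\<close>, integrate, and the moments of \<open>\<mu>\<close> turn the binomial
  coefficients into those built from Dunkl factorials.
\<close>

lemma dunkl_translation_monomial:
  assumes "k \<ge> 0" and V: "intertwining_operator k V" and \<mu>: "representing_measures V \<mu>"
  shows "dunkl_translation V \<mu> x (\<lambda>y. y ^ n) y =
    (\<Sum>j\<le>n. dunkl_fact k n / (dunkl_fact k j * dunkl_fact k (n - j)) * x ^ j * y ^ (n - j))"
proof -
  define c where "c = dunkl_fact k n / fact n"
  have pos: "dunkl_fact k j > 0" for j
    using dunkl_fact_pos[OF assms(1)] .
  have inner: "(LINT z|\<mu> x. c * (z + \<eta>) ^ n) =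
      (\<Sum>j\<le>n. c * (real (n choose j) * (fact j / dunkl_fact k j * x ^ j) * \<eta> ^ (n - j)))" for \<eta>
  proof -
    have "(LINT z|\<mu> x. c * (z + \<eta>) ^ n)
        = (LINT z|\<mu> x. (\<Sum>j\<le>n. c * real (n choose j) * \<eta> ^ (n - j) * z ^ j))"
      by (simp add: binomial_ring sum_distrib_left mult_ac)
    also have "\<dots> = (\<Sum>j\<le>n. LINT z|\<mu> x. c * real (n choose j) * \<eta> ^ (n - j) * z ^ j)"
      by (intro Bochner_Integration.integral_sum integrable_representing[OF \<mu>] continuous_intros)
    also have "\<dots> = (\<Sum>j\<le>n. c * real (n choose j) * \<eta> ^ (n - j) * (LINT z|\<mu> x. z ^ j))"
      by simp
    finally show ?thesis
      by (simp add: representing_moment[OF assms] mult_ac)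
  qed
  have "dunkl_translation V \<mu> x (\<lambda>y. y ^ n) y = (LINT \<eta>|\<mu> y. (LINT z|\<mu> x. c * (z + \<eta>) ^ n))"
    by (simp only: dunkl_translation_def inv_intertwining_monomial[OF assms(1,2)] c_def)
  also have "\<dots> = (\<Sum>j\<le>n. LINT \<eta>|\<mu> y.
      c * (real (n choose j) * (fact j / dunkl_fact k j * x ^ j) * \<eta> ^ (n - j)))"
    unfolding inner
    by (intro Bochner_Integration.integral_sum integrable_representing[OF \<mu>] continuous_intros)
  also have "\<dots> = (\<Sum>j\<le>n. c * (real (n choose j) * (fact j / dunkl_fact k j * x ^ j) *
      (fact (n - j) / dunkl_fact k (n - j) * y ^ (n - j))))"
    by (intro sum.cong refl) (simp add: representing_moment[OF assms])
  also have "\<dots> = (\<Sum>j\<le>n. dunkl_fact k n / (dunkl_fact k j * dunkl_fact k (n - j)) * x ^ j * y ^ (n - j))"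
    using pos by (intro sum.cong refl) (auto simp: c_def binomial_fact divide_simps mult_ac)
  finally show ?thesis .
qed

text \<open>
  The weight is even, so the mean is the average of the translations at \<open>r\<close> and \<open>-r\<close>, in which the odd
  powers of \<open>r\<close> cancel. Having compact support, \<open>\<sigma>\<close> is determined by these moments.
\<close>

lemma dunkl_sphere_moment:
  assumes "k \<ge> 0" and "intertwining_operator k V" and "representing_measures V \<mu>"
    and M: "dunkl_sphere_measure k V \<mu> x r M"
  shows "(LINT y|M. y ^ n) =
    (\<Sum>j\<le>n. if even (n - j) then dunkl_fact k n / (dunkl_fact k j * dunkl_fact k (n - j)) *
        x ^ j * r ^ (n - j) else 0)"
proof -
  let ?w = "dunkl_weight k 1"
  have w: "?w > 0" "dunkl_weight k (- 1) = ?w"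
    by (auto simp: dunkl_weight_def)
  have "(LINT y|M. y ^ n) = (1 / (?w + ?w)) *
      (dunkl_translation V \<mu> x (\<lambda>y. y ^ n) r * ?w + dunkl_translation V \<mu> x (\<lambda>y. y ^ n) (- r) * ?w)"
    using M monomial_smooth[of 1 n] w unfolding dunkl_sphere_measure_def by simp
  also have "\<dots> = (dunkl_translation V \<mu> x (\<lambda>y. y ^ n) r + dunkl_translation V \<mu> x (\<lambda>y. y ^ n) (- r)) / 2"
    using w by (simp add: field_simps)
  also have "\<dots> = (\<Sum>j\<le>n. dunkl_fact k n / (dunkl_fact k j * dunkl_fact k (n - j)) *
      x ^ j * ((r ^ (n - j) + (- r) ^ (n - j)) / 2))"
    unfolding dunkl_translation_monomial[OF assms(1-3)] sum.distrib[symmetric] sum_divide_distrib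
    by (simp add: algebra_simps add_divide_distrib)
  also have "\<dots> = (\<Sum>j\<le>n. if even (n - j) then dunkl_fact k n / (dunkl_fact k j * dunkl_fact k (n - j)) *
        x ^ j * r ^ (n - j) else 0)"
    by (intro sum.cong refl) auto
  finally show ?thesis .
qed

section \<open>A three-term recurrence for the moments\<close>

text \<open>
  The power series coefficients of the hypergeometric function \<open>0F1(; a; t)\<close>, that is, of a
  normalised Bessel function. For \<open>a = k + 1/2\<close> their inverses are the Dunkl factorials of even
  index, up to powers of \<open>4\<close>.
\<close>

definition bessel_coeff :: "real \<Rightarrow> nat \<Rightarrow> real" where
  "bessel_coeff a n = 1 / (fact n * pochhammer a n)"

lemma bessel_coeff_pos: "a > 0 \<Longrightarrow> bessel_coeff a n > 0"
  by (simp add: bessel_coeff_def pochhammer_pos)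

lemma bessel_coeff_Suc:
  assumes "a > 0"
  shows "bessel_coeff a n = real (Suc n) * (a + real n) * bessel_coeff a (Suc n)"
proof -
  have "a + real n \<noteq> 0" "pochhammer a n \<noteq> 0"
    using assms pochhammer_pos[OF assms, of n] by auto
  then show ?thesis
    unfolding bessel_coeff_def pochhammer_rec' fact_Suc of_nat_mult by (simp add: divide_simps)
qed

text \<open>
  Summed over \<open>i \<le> n\<close>, these terms give the coefficient of \<open>t\<^sup>n\<close> in the product
  \<open>0F1(; a; X t) 0F1(; a; R t)\<close> of two normalised Bessel functions.
\<close>

definition bessel_term :: "real \<Rightarrow> real \<Rightarrow> real \<Rightarrow> nat \<Rightarrow> nat \<Rightarrow> real" where
  "bessel_term a X R n i = (bessel_coeff a i * X ^ i) * (bessel_coeff a (n - i) * R ^ (n - i))"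

text \<open>
  Multiplication by \<open>X\<close> or by \<open>R\<close> raises the degree by one at the price of a polynomial weight in
  the index. All sums in a recurrence can thus be brought to a common degree and compared termwise.
\<close>

lemma sum_bessel_term_shift:
  assumes "a > 0"
  shows "(\<Sum>i\<le>n. g (Suc i) * X * bessel_term a X R n i)
       = (\<Sum>i\<le>Suc n. g i * (real i * (a + real i - 1)) * bessel_term a X R (Suc n) i)"
    and "(\<Sum>i\<le>n. g i * R * bessel_term a X R n i)
       = (\<Sum>i\<le>Suc n. g i * ((real n + 1 - real i) * (a + real n - real i)) * bessel_term a X R (Suc n) i)"
proof -
  have "X * bessel_term a X R n i
      = real (Suc i) * (a + real i) * bessel_term a X R (Suc n) (Suc i)" for i
    using bessel_coeff_Suc[OF assms, of i] by (simp add: bessel_term_def)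
  then show "(\<Sum>i\<le>n. g (Suc i) * X * bessel_term a X R n i)
       = (\<Sum>i\<le>Suc n. g i * (real i * (a + real i - 1)) * bessel_term a X R (Suc n) i)"
    unfolding sum.atMost_Suc_shift by (simp add: mult.assoc)
  have "R * bessel_term a X R n i
      = (real n + 1 - real i) * (a + real n - real i) * bessel_term a X R (Suc n) i" if "i \<le> n" for i
  proof -
    have "Suc n - i = Suc (n - i)" using that by auto
    moreover have "bessel_coeff a (n - i)
        = (real n + 1 - real i) * (a + real n - real i) * bessel_coeff a (Suc (n - i))"
      using bessel_coeff_Suc[OF assms, of "n - i"] that by (simp add: of_nat_diff add_ac diff_add_eq add_diff_eq)
    ultimately show ?thesis
      by (simp add: bessel_term_def)
  qed
  then show "(\<Sum>i\<le>n. g i * R * bessel_term a X R n i)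
       = (\<Sum>i\<le>Suc n. g i * ((real n + 1 - real i) * (a + real n - real i)) * bessel_term a X R (Suc n) i)"
    by (simp add: mult.assoc)
qed

text \<open>
  This is the three-term recurrence of the Gegenbauer polynomials in disguise. After all sums are
  shifted to degree \<open>n + 2\<close>, it becomes a polynomial identity in \<open>i\<close>, \<open>n\<close> and \<open>a\<close>.
\<close>

lemma sum_bessel_term_recurrence:
  fixes a X R :: real
  assumes "a > 0"
  defines "T \<equiv> \<lambda>n. \<Sum>i\<le>n. bessel_term a X R n i"
  shows "(2 * a + real n) * (real n + 2) * (a + real n + 1) * (a + real n) * T (Suc (Suc n))
       = (2 * a + 2 * real n + 1) * (a + real n) * (X + R) * T (Suc n) - (X - R)\<^sup>2 * T n"
proof -
  let ?t = "bessel_term a X R"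
  let ?i = "\<lambda>i. real i * (a + real i - 1)"
  let ?l = "\<lambda>n i. (real n + 1 - real i) * (a + real n - real i)"
  note shift = sum_bessel_term_shift[OF assms(1)]
  have X: "X * T m = (\<Sum>i\<le>Suc m. ?i i * ?t (Suc m) i)" for m
    using shift(1)[of "\<lambda>_. 1" X R m] by (simp add: T_def sum_distrib_left)
  have R: "R * T m = (\<Sum>i\<le>Suc m. ?l m i * ?t (Suc m) i)" for m
    using shift(2)[of "\<lambda>_. 1" R X m] by (simp add: T_def sum_distrib_left)
  have XX: "X * (X * T n) = (\<Sum>i\<le>Suc (Suc n). (real i - 1) * (a + real i - 2) * ?i i * ?t (Suc (Suc n)) i)"
    unfolding X using shift(1)[of "\<lambda>i. (real i - 1) * (a + real i - 2)" X R "Suc n"]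
    by (simp add: sum_distrib_left mult_ac del: sum.atMost_Suc)
  have RX: "R * (X * T n) = (\<Sum>i\<le>Suc (Suc n). ?i i * ?l (Suc n) i * ?t (Suc (Suc n)) i)"
    unfolding X using shift(2)[of ?i R X "Suc n"]
    by (simp add: sum_distrib_left mult_ac del: sum.atMost_Suc)
  have RR: "R * (R * T n) = (\<Sum>i\<le>Suc (Suc n). ?l n i * ?l (Suc n) i * ?t (Suc (Suc n)) i)"
    unfolding R using shift(2)[of "?l n" R X "Suc n"]
    by (simp add: sum_distrib_left mult_ac del: sum.atMost_Suc)
  have "(2 * a + 2 * real n + 1) * (a + real n) * (X + R) * T (Suc n) - (X - R)\<^sup>2 * T n
      = (2 * a + 2 * real n + 1) * (a + real n) * (X * T (Suc n) + R * T (Suc n))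
        - (X * (X * T n) - 2 * (R * (X * T n)) + R * (R * T n))"
    by (simp add: algebra_simps power2_eq_square)
  also have "\<dots> = (\<Sum>i\<le>Suc (Suc n).
      ((2 * a + 2 * real n + 1) * (a + real n) * (?i i + ?l (Suc n) i)
        - ((real i - 1) * (a + real i - 2) * ?i i - 2 * (?i i * ?l (Suc n) i) + ?l n i * ?l (Suc n) i))
      * ?t (Suc (Suc n)) i)"
    unfolding XX RX RR X[of "Suc n"] R[of "Suc n"]
    unfolding sum_distrib_left sum_subtractf[symmetric] sum.distrib[symmetric]
    by (intro sum.cong refl) (simp add: algebra_simps)
  also have "\<dots> = (\<Sum>i\<le>Suc (Suc n).
      ((2 * a + real n) * (real n + 2) * (a + real n + 1) * (a + real n)) * ?t (Suc (Suc n)) i)"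
    by (intro sum.cong refl arg_cong2[where f = "(*)"]) (simp add: algebra_simps)
  finally show ?thesis
    by (simp only: T_def sum_distrib_left)
qed


lemma dunkl_fact_even:
  assumes "k \<ge> 0"
  shows "dunkl_fact k (2 * m) = 4 ^ m / bessel_coeff (k + 1 / 2) m"
proof (induction m)
  case 0
  then show ?case by (simp add: bessel_coeff_def)
next
  have pos: "k + 1 / 2 > 0" using assms by simp
  case (Suc m)
  have "dunkl_fact k (2 * Suc m) = 4 * (real (Suc m) * (k + 1 / 2 + real m)) * dunkl_fact k (2 * m)"
    by (simp add: algebra_simps)
  also have "\<dots> = 4 ^ Suc m * (real (Suc m) * (k + 1 / 2 + real m) / bessel_coeff (k + 1 / 2) m)"
    by (simp only: Suc) simp
  also have "real (Suc m) * (k + 1 / 2 + real m) / bessel_coeff (k + 1 / 2) m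
      = 1 / bessel_coeff (k + 1 / 2) (Suc m)"
    unfolding bessel_coeff_Suc[of "k + 1 / 2" m, OF pos]
    using assms bessel_coeff_pos[OF pos, of "Suc m"] by (simp add: divide_simps)
  finally show ?case
    by simp
qed

lemma dunkl_fact_odd: "dunkl_fact k (Suc (2 * m)) = 2 * (k + 1 / 2 + real m) * dunkl_fact k (2 * m)"
  by (simp add: algebra_simps)

lemma sum_even_odd_indices:
  fixes g :: "nat \<Rightarrow> real"
  shows "(\<Sum>j\<le>2 * m. if even (2 * m - j) then g j else 0) = (\<Sum>i\<le>m. g (2 * i))"
    and "(\<Sum>j\<le>Suc (2 * m). if even (Suc (2 * m) - j) then g j else 0) = (\<Sum>i\<le>m. g (Suc (2 * i)))"
proof -
  have "(\<Sum>j\<le>2 * m. if even j then g j else 0) = (\<Sum>i\<le>m. g (2 * i))"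
    by (induction m) auto
  moreover have "(\<Sum>j\<le>2 * m. if even (2 * m - j) then g j else 0) = (\<Sum>j\<le>2 * m. if even j then g j else 0)"
    by (intro sum.cong refl) (auto simp: even_diff_nat)
  ultimately show "(\<Sum>j\<le>2 * m. if even (2 * m - j) then g j else 0) = (\<Sum>i\<le>m. g (2 * i))"
    by simp
  have "(\<Sum>j\<le>Suc (2 * m). if odd j then g j else 0) = (\<Sum>i\<le>m. g (Suc (2 * i)))"
    by (induction m) auto
  moreover have "(\<Sum>j\<le>Suc (2 * m). if even (Suc (2 * m) - j) then g j else 0)
      = (\<Sum>j\<le>Suc (2 * m). if odd j then g j else 0)"
    by (intro sum.cong refl) (auto simp: even_diff_nat)
  ultimately show "(\<Sum>j\<le>Suc (2 * m). if even (Suc (2 * m) - j) then g j else 0) = (\<Sum>i\<le>m. g (Suc (2 * i)))"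
    by simp
qed

lemma dunkl_sphere_even_moment:
  assumes "k \<ge> 0" and "intertwining_operator k V" and "representing_measures V \<mu>"
    and "dunkl_sphere_measure k V \<mu> x r M"
  shows "(LINT y|M. y ^ (2 * m)) =
    (\<Sum>i\<le>m. bessel_term (k + 1 / 2) (x\<^sup>2) (r\<^sup>2) m i) / bessel_coeff (k + 1 / 2) m"
proof -
  have "dunkl_fact k (2 * m) / (dunkl_fact k (2 * i) * dunkl_fact k (2 * m - 2 * i)) *
      x ^ (2 * i) * r ^ (2 * m - 2 * i)
    = bessel_term (k + 1 / 2) (x\<^sup>2) (r\<^sup>2) m i / bessel_coeff (k + 1 / 2) m" if i: "i \<le> m" for i
  proof -
    obtain l where m: "m = i + l"
      using le_Suc_ex[OF i] by blast
    then have eq: "2 * m - 2 * i = 2 * l" "m - i = l" and pow: "(4::real) ^ m = 4 ^ i * 4 ^ l"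
      by (auto simp: power_add)
    have nz: "bessel_coeff (k + 1 / 2) j \<noteq> 0" for j
      using bessel_coeff_pos[of "k + 1 / 2" j] assms(1) by simp
    have cancel: "p * q / C / (p / A * (q / B)) * u * w = A * u * (B * w) / C"
      if "p \<noteq> 0" "q \<noteq> 0" "A \<noteq> 0" "B \<noteq> 0" "C \<noteq> 0" for p q A B C u w :: real
      using that by (simp add: field_simps)
    show ?thesis
      unfolding eq dunkl_fact_even[OF assms(1)] bessel_term_def power_mult pow
      by (rule cancel) (use nz in auto)
  qed
  then show ?thesis
    unfolding dunkl_sphere_moment[OF assms] sum_even_odd_indices sum_divide_distrib
    by (intro sum.cong refl) simp
qed

text \<open>
  The odd moments are tied to the even ones as if \<open>2 x y = y\<^sup>2 + x\<^sup>2 - r\<^sup>2\<close> held under the integral, against even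
  powers of \<open>y\<close>; this is the law of cosines. In degree \<open>m + 1\<close> the identity reduces to a linear relation between the weights
  of the individual terms.
\<close>

lemma dunkl_sphere_odd_moment:
  assumes "k \<ge> 0" and "intertwining_operator k V" and "representing_measures V \<mu>"
    and "dunkl_sphere_measure k V \<mu> x r M"
  shows "2 * x * (LINT y|M. y ^ Suc (2 * m)) =
    (LINT y|M. y ^ (2 * Suc m)) + (x\<^sup>2 - r\<^sup>2) * (LINT y|M. y ^ (2 * m))"
proof -
  define a where "a = k + 1 / 2"
  have a: "a > 0"
    using assms(1) by (simp add: a_def)
  define b where "b = bessel_coeff a m"
  have b: "b > 0" "b = real (Suc m) * (a + real m) * bessel_coeff a (Suc m)"
    using bessel_coeff_pos[OF a, of m] bessel_coeff_Suc[OF a, of m] by (simp_all add: b_def)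
  let ?X = "x\<^sup>2" and ?R = "r\<^sup>2"
  let ?t = "bessel_term a ?X ?R"
  note shift = sum_bessel_term_shift[OF a]
  have summand: "2 * x * (dunkl_fact k (Suc (2 * m)) /
        (dunkl_fact k (Suc (2 * i)) * dunkl_fact k (Suc (2 * m) - Suc (2 * i))) *
        x ^ Suc (2 * i) * r ^ (Suc (2 * m) - Suc (2 * i)))
      = 2 * (a + real m) / b * (1 / (a + real i) * ?X * ?t m i)" if i: "i \<le> m" for i
  proof -
    obtain l where m: "m = i + l"
      using le_Suc_ex[OF i] by blast
    then have eq: "Suc (2 * m) - Suc (2 * i) = 2 * l" "m - i = l" and pow: "(4::real) ^ m = 4 ^ i * 4 ^ l"
      by (auto simp: power_add)
    have nz: "bessel_coeff a j \<noteq> 0" for j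
      using bessel_coeff_pos[OF a, of j] by simp
    have cancel: "2 * x * (2 * c * (p * q / C) / (2 * d * (p / A) * (q / B)) * (x * u) * w)
        = 2 * c / C * (1 / d * x\<^sup>2 * (A * u * (B * w)))"
      if "p \<noteq> 0" "q \<noteq> 0" "A \<noteq> 0" "B \<noteq> 0" "C \<noteq> 0" "d \<noteq> 0" for p q A B C u w c d :: real
      using that by (simp add: field_simps power2_eq_square)
    show ?thesis
      unfolding eq bessel_term_def dunkl_fact_odd dunkl_fact_even[OF assms(1)] a_def[symmetric] b_def
        power_Suc power_mult pow
      by (rule cancel) (use nz a in \<open>auto simp: add_pos_nonneg less_imp_neq[symmetric]\<close>)
  qed
  have "2 * x * (LINT y|M. y ^ Suc (2 * m))
      = (\<Sum>i\<le>m. 2 * (a + real m) / b * (1 / (a + real i) * ?X * ?t m i))"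
    unfolding dunkl_sphere_moment[OF assms] sum_even_odd_indices sum_distrib_left
    by (intro sum.cong refl) (simp only: summand atMost_iff)
  also have "\<dots> = 2 * (a + real m) / b * (\<Sum>i\<le>m. 1 / (a + real (Suc i) - 1) * ?X * ?t m i)"
    by (simp add: sum_distrib_left)
  also have "\<dots> = 2 * (a + real m) / b *
      (\<Sum>i\<le>Suc m. 1 / (a + real i - 1) * (real i * (a + real i - 1)) * ?t (Suc m) i)"
    unfolding shift(1)[of "\<lambda>i. 1 / (a + real i - 1)"] ..
  also have "\<dots> = 2 * (a + real m) / b * (\<Sum>i\<le>Suc m. real i * ?t (Suc m) i)"
  proof -
    have "1 / (a + real i - 1) * (real i * (a + real i - 1)) = real i" for i
      using a by (cases i) auto
    then show ?thesis by simp
  qed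
  also have "\<dots> = (\<Sum>i\<le>Suc m. 2 * (a + real m) * real i * ?t (Suc m) i) / b"
    unfolding sum_divide_distrib sum_distrib_left by (intro sum.cong refl) simp
  also have "\<dots> = (\<Sum>i\<le>Suc m. (real (Suc m) * (a + real m) + real i * (a + real i - 1)
      - (real m + 1 - real i) * (a + real m - real i)) * ?t (Suc m) i) / b"
    by (intro arg_cong2[where f = "(/)"] sum.cong refl arg_cong2[where f = "(*)"]) (simp add: algebra_simps)
  also have "\<dots> = (real (Suc m) * (a + real m) * (\<Sum>i\<le>Suc m. ?t (Suc m) i)
      + (?X - ?R) * (\<Sum>i\<le>m. ?t m i)) / b"
    using shift(1)[of "\<lambda>_. 1" ?X ?R m] shift(2)[of "\<lambda>_. 1" ?R ?X m]
    by (simp add: left_diff_distrib distrib_right sum_subtractf sum.distrib sum_distrib_left mult.assoc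
        del: sum.atMost_Suc)
  also have "\<dots> = (\<Sum>i\<le>Suc m. ?t (Suc m) i) / bessel_coeff a (Suc m)
      + (?X - ?R) * ((\<Sum>i\<le>m. ?t m i) / bessel_coeff a m)"
  proof -
    have "real (Suc m) * (a + real m) / b = 1 / bessel_coeff a (Suc m)"
      using b a bessel_coeff_pos[OF a, of "Suc m"] by (simp add: divide_simps)
    then have "real (Suc m) * (a + real m) * S / b = S / bessel_coeff a (Suc m)" for S
      by (metis times_divide_eq_left mult.left_neutral)
    then show ?thesis
      by (simp only: add_divide_distrib b_def times_divide_eq_right)
  qed
  finally show ?thesis
    by (simp only: dunkl_sphere_even_moment[OF assms] a_def)
qed

section \<open>Moments of a chord with random angle\<close>

text \<open>
  The squared length of the third side of a triangle with sides \<open>\<bar>x\<bar>\<close> and \<open>r\<close>; the angle is measured so that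
  the side is longest for \<open>\<theta> = 0\<close>. The absolute value makes everything below covariant under
  scalings of either sign.
\<close>

definition chord_sq :: "real \<Rightarrow> real \<Rightarrow> real \<Rightarrow> real" where
  "chord_sq x r \<theta> = x\<^sup>2 + r\<^sup>2 + 2 * \<bar>x\<bar> * r * cos \<theta>"

text \<open>
  Up to normalisation, the density of the polar angle on a sphere of dimension \<open>2k\<close>. For \<open>k > 1/2\<close> the exponent is positive,
  so that the density is continuous up to the end points.
\<close>

definition angle_weight :: "real \<Rightarrow> real \<Rightarrow> real" where
  "angle_weight k \<theta> = sin \<theta> powr (2 * k - 1)"

definition angle_moment :: "real \<Rightarrow> real \<Rightarrow> real \<Rightarrow> nat \<Rightarrow> real" where
  "angle_moment k x r n = integral {0..pi} (\<lambda>\<theta>. chord_sq x r \<theta> ^ n * angle_weight k \<theta>)"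

lemma continuous_on_sin_powr:
  assumes "e > 0"
  shows "continuous_on {0..pi} (\<lambda>\<theta>. sin \<theta> powr e)"
  using assms by (intro continuous_on_powr' continuous_intros) (auto simp: sin_ge_zero)

lemma continuous_on_angle_weight: "k > 1 / 2 \<Longrightarrow> continuous_on {0..pi} (angle_weight k)"
  unfolding angle_weight_def by (rule continuous_on_sin_powr) simp

lemma continuous_on_chord_sq: "continuous_on S (chord_sq x r)"
  unfolding chord_sq_def by (intro continuous_intros)

lemma angle_weight_nonneg: "angle_weight k \<theta> \<ge> 0"
  by (simp add: angle_weight_def)

lemma angle_weight_integrable:
  fixes f :: "real \<Rightarrow> real"
  assumes "k > 1 / 2" and "continuous_on {0..pi} f"
  shows "(\<lambda>\<theta>. f \<theta> * angle_weight k \<theta>) integrable_on {0..pi}"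
  by (intro integrable_continuous_interval continuous_on_mult continuous_on_angle_weight assms)

text \<open>
  The integrand is the derivative of \<open>sin\<^sup>2\<^sup>k g\<close>, which vanishes at both ends.
\<close>

lemma integral_angle_weight_by_parts:
  assumes k: "k > 1 / 2" and g: "continuous_on {0..pi} g"
    and g': "\<And>\<theta>. \<theta> \<in> {0<..<pi} \<Longrightarrow> (g has_real_derivative g' \<theta>) (at \<theta>)"
  shows "((\<lambda>\<theta>. (2 * k * cos \<theta> * g \<theta> + sin \<theta> * g' \<theta>) * angle_weight k \<theta>) has_integral 0) {0..pi}"
proof -
  let ?f = "\<lambda>\<theta>. sin \<theta> powr (2 * k) * g \<theta>"
  have "((\<lambda>\<theta>. (2 * k * cos \<theta> * g \<theta> + sin \<theta> * g' \<theta>) * angle_weight k \<theta>)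
      has_integral (?f pi - ?f 0)) {0..pi}"
  proof (rule fundamental_theorem_of_calculus_interior)
    show "continuous_on {0..pi} ?f"
      using k by (intro continuous_on_mult continuous_on_sin_powr g) auto
    fix \<theta> :: real assume \<theta>: "\<theta> \<in> {0<..<pi}"
    then have sin: "sin \<theta> > 0" by (simp add: sin_gt_zero)
    have "sin \<theta> powr (2 * k) = sin \<theta> * sin \<theta> powr (2 * k - 1)"
      using sin by (simp add: powr_diff)
    moreover have "(?f has_real_derivative
        2 * k * sin \<theta> powr (2 * k - 1) * cos \<theta> * g \<theta> + sin \<theta> powr (2 * k) * g' \<theta>) (at \<theta>)"
      using sin by (auto intro!: derivative_eq_intros g'[OF \<theta>])
    ultimately show "(?f has_vector_derivative
        (2 * k * cos \<theta> * g \<theta> + sin \<theta> * g' \<theta>) * angle_weight k \<theta>) (at \<theta>)"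
      by (simp add: angle_weight_def has_real_derivative_iff_has_vector_derivative[symmetric] algebra_simps)
  qed simp
  then show ?thesis by simp
qed

text \<open>
  Integrate by parts with \<open>g\<close> a power of \<open>chord_sq\<close>. Since \<open>cos\<close> is an affine function of
  \<open>chord_sq\<close>, the result can be rewritten in terms of powers of \<open>chord_sq\<close> alone.
\<close>

lemma angle_moment_recurrence:
  assumes k: "k > 1 / 2" and "x \<noteq> 0" and "r > 0"
  shows "angle_moment k x r 1 = (x\<^sup>2 + r\<^sup>2) * angle_moment k x r 0"
    and "(2 * k + 1 + real n) * angle_moment k x r (Suc (Suc n)) =
      2 * (k + 1 + real n) * (x\<^sup>2 + r\<^sup>2) * angle_moment k x r (Suc n)
      - real (Suc n) * (x\<^sup>2 - r\<^sup>2)\<^sup>2 * angle_moment k x r n"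
proof -
  let ?v = "chord_sq x r" and ?w = "angle_weight k"
  define b where "b = 2 * \<bar>x\<bar> * r"
  have b: "b \<noteq> 0" and b2: "b\<^sup>2 = (x\<^sup>2 + r\<^sup>2)\<^sup>2 - (x\<^sup>2 - r\<^sup>2)\<^sup>2"
    using assms by (auto simp: b_def power_mult_distrib) (simp add: power2_eq_square algebra_simps)
  have v: "b * cos \<theta> = ?v \<theta> - (x\<^sup>2 + r\<^sup>2)" for \<theta>
    by (simp add: chord_sq_def b_def)
  have M: "((\<lambda>\<theta>. ?v \<theta> ^ n * ?w \<theta>) has_integral angle_moment k x r n) {0..pi}" for n
    unfolding angle_moment_def
    by (intro integrable_integral angle_weight_integrable k continuous_intros continuous_on_chord_sq)
  have parts: "((\<lambda>\<theta>. (2 * k * (?v \<theta> - (x\<^sup>2 + r\<^sup>2)) * ?v \<theta> ^ n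
      - (b\<^sup>2 - (?v \<theta> - (x\<^sup>2 + r\<^sup>2))\<^sup>2) * (real n * ?v \<theta> ^ (n - 1))) * ?w \<theta>) has_integral 0) {0..pi}" for n
  proof -
    have "((\<lambda>\<theta>. b * ((2 * k * cos \<theta> * ?v \<theta> ^ n
        + sin \<theta> * (real n * ?v \<theta> ^ (n - 1) * (- b * sin \<theta>))) * ?w \<theta>)) has_integral b * 0) {0..pi}"
    proof (intro has_integral_mult_right integral_angle_weight_by_parts k continuous_intros
        continuous_on_chord_sq)
      show "((\<lambda>\<theta>. ?v \<theta> ^ n) has_real_derivative real n * ?v \<theta> ^ (n - 1) * (- b * sin \<theta>)) (at \<theta>)" for \<theta>
        unfolding chord_sq_def b_def by (auto intro!: derivative_eq_intros)
    qed
    moreover have "b * ((2 * k * cos \<theta> * ?v \<theta> ^ n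
        + sin \<theta> * (real n * ?v \<theta> ^ (n - 1) * (- b * sin \<theta>))) * ?w \<theta>)
      = (2 * k * (b * cos \<theta>) * ?v \<theta> ^ n
        - (b\<^sup>2 - (b * cos \<theta>)\<^sup>2) * (real n * ?v \<theta> ^ (n - 1))) * ?w \<theta>" for \<theta>
    proof -
      have "b\<^sup>2 - (b * cos \<theta>)\<^sup>2 = b * b * (sin \<theta> * sin \<theta>)"
        by (simp add: power_mult_distrib cos_squared_eq right_diff_distrib flip: power2_eq_square)
      then show ?thesis by (simp only:) (simp add: algebra_simps)
    qed
    ultimately show ?thesis
      by (simp only: v mult_zero_right)
  qed
  have "((\<lambda>\<theta>. 2 * k * (?v \<theta> ^ 1 * ?w \<theta>) - 2 * k * (x\<^sup>2 + r\<^sup>2) * (?v \<theta> ^ 0 * ?w \<theta>)) has_integral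
      2 * k * angle_moment k x r 1 - 2 * k * (x\<^sup>2 + r\<^sup>2) * angle_moment k x r 0) {0..pi}"
    by (intro has_integral_diff has_integral_mult_right M)
  with parts[of 0] have "2 * k * angle_moment k x r 1 - 2 * k * (x\<^sup>2 + r\<^sup>2) * angle_moment k x r 0 = 0"
    by (intro has_integral_unique) (auto simp: algebra_simps)
  then have "2 * k * (angle_moment k x r 1 - (x\<^sup>2 + r\<^sup>2) * angle_moment k x r 0) = 0"
    by (simp add: algebra_simps)
  then show "angle_moment k x r 1 = (x\<^sup>2 + r\<^sup>2) * angle_moment k x r 0"
    using k by simp
  have "((\<lambda>\<theta>. (2 * k + 1 + real n) * (?v \<theta> ^ Suc (Suc n) * ?w \<theta>)
        - 2 * (k + 1 + real n) * (x\<^sup>2 + r\<^sup>2) * (?v \<theta> ^ Suc n * ?w \<theta>)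
        + real (Suc n) * (x\<^sup>2 - r\<^sup>2)\<^sup>2 * (?v \<theta> ^ n * ?w \<theta>)) has_integral
      (2 * k + 1 + real n) * angle_moment k x r (Suc (Suc n))
        - 2 * (k + 1 + real n) * (x\<^sup>2 + r\<^sup>2) * angle_moment k x r (Suc n)
        + real (Suc n) * (x\<^sup>2 - r\<^sup>2)\<^sup>2 * angle_moment k x r n) {0..pi}"
    by (intro has_integral_diff has_integral_add has_integral_mult_right M)
  moreover have "(2 * k * (?v \<theta> - (x\<^sup>2 + r\<^sup>2)) * ?v \<theta> ^ Suc n
      - (b\<^sup>2 - (?v \<theta> - (x\<^sup>2 + r\<^sup>2))\<^sup>2) * (real (Suc n) * ?v \<theta> ^ (Suc n - 1))) * ?w \<theta>
    = (2 * k + 1 + real n) * (?v \<theta> ^ Suc (Suc n) * ?w \<theta>)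
        - 2 * (k + 1 + real n) * (x\<^sup>2 + r\<^sup>2) * (?v \<theta> ^ Suc n * ?w \<theta>)
        + real (Suc n) * (x\<^sup>2 - r\<^sup>2)\<^sup>2 * (?v \<theta> ^ n * ?w \<theta>)" for \<theta>
    unfolding b2 by (simp add: power2_diff[of "?v \<theta>"]) (simp add: algebra_simps power2_eq_square)
  ultimately have "(2 * k + 1 + real n) * angle_moment k x r (Suc (Suc n))
        - 2 * (k + 1 + real n) * (x\<^sup>2 + r\<^sup>2) * angle_moment k x r (Suc n)
        + real (Suc n) * (x\<^sup>2 - r\<^sup>2)\<^sup>2 * angle_moment k x r n = 0"
    using parts[of "Suc n"] by (simp only:) (rule has_integral_unique)
  then show "(2 * k + 1 + real n) * angle_moment k x r (Suc (Suc n)) =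
      2 * (k + 1 + real n) * (x\<^sup>2 + r\<^sup>2) * angle_moment k x r (Suc n)
      - real (Suc n) * (x\<^sup>2 - r\<^sup>2)\<^sup>2 * angle_moment k x r n"
    by linarith
qed

text \<open>
  Both sequences satisfy the same three-term recurrence with the same first two terms (relative to
  the total mass). Therefore, under \<open>\<sigma>\<close>, the square \<open>y\<^sup>2\<close> is distributed like \<open>chord_sq\<close> under the normalised
  angular density.
\<close>

lemma angle_moment_eq:
  assumes k: "k > 1 / 2" and x: "x \<noteq> 0" and r: "r > 0"
  shows "angle_moment k x r n = angle_moment k x r 0 *
    ((\<Sum>i\<le>n. bessel_term (k + 1 / 2) (x\<^sup>2) (r\<^sup>2) n i) / bessel_coeff (k + 1 / 2) n)"
proof -
  define a where "a = k + 1 / 2"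
  have a: "a > 0" using k by (simp add: a_def)
  define T where "T n = (\<Sum>i\<le>n. bessel_term a (x\<^sup>2) (r\<^sup>2) n i)" for n
  define S where "S n = T n / bessel_coeff a n" for n
  have T: "T n = S n * bessel_coeff a n" for n
    using bessel_coeff_pos[OF a, of n] by (simp add: S_def)
  have S0: "S 0 = 1" and S1: "S 1 = x\<^sup>2 + r\<^sup>2"
    using a by (auto simp: S_def T_def bessel_term_def bessel_coeff_def field_simps)
  have S: "(2 * k + 1 + real n) * S (Suc (Suc n)) =
      2 * (k + 1 + real n) * (x\<^sup>2 + r\<^sup>2) * S (Suc n) - real (Suc n) * (x\<^sup>2 - r\<^sup>2)\<^sup>2 * S n" for n
  proof -
    define c where "c = bessel_coeff a (Suc (Suc n))"
    have c: "c > 0" using bessel_coeff_pos[OF a] by (simp add: c_def)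
    have c1: "bessel_coeff a (Suc n) = real (Suc (Suc n)) * (a + real (Suc n)) * c"
      using bessel_coeff_Suc[OF a, of "Suc n"] by (simp add: c_def)
    have c0: "bessel_coeff a n = real (Suc n) * (a + real n) * (real (Suc (Suc n)) * (a + real (Suc n)) * c)"
      using bessel_coeff_Suc[OF a, of n] unfolding c1 .
    have "(2 * a + real n) * (real n + 2) * (a + real n + 1) * (a + real n) * T (Suc (Suc n))
       = (2 * a + 2 * real n + 1) * (a + real n) * (x\<^sup>2 + r\<^sup>2) * T (Suc n) - (x\<^sup>2 - r\<^sup>2)\<^sup>2 * T n"
      unfolding T_def by (rule sum_bessel_term_recurrence[OF a])
    then have "((real n + 2) * (a + real n + 1) * (a + real n) * c) *
        ((2 * a + real n) * S (Suc (Suc n)))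
       = ((real n + 2) * (a + real n + 1) * (a + real n) * c) *
        ((2 * a + 2 * real n + 1) * (x\<^sup>2 + r\<^sup>2) * S (Suc n) - real (Suc n) * (x\<^sup>2 - r\<^sup>2)\<^sup>2 * S n)"
      unfolding T c_def[symmetric] c1 c0 by (simp add: algebra_simps)
    moreover have "(real n + 2) * (a + real n + 1) * (a + real n) * c \<noteq> 0"
      using a c by (auto simp: add_pos_nonneg less_imp_neq[symmetric])
    ultimately have "(2 * a + real n) * S (Suc (Suc n))
       = (2 * a + 2 * real n + 1) * (x\<^sup>2 + r\<^sup>2) * S (Suc n) - real (Suc n) * (x\<^sup>2 - r\<^sup>2)\<^sup>2 * S n"
      using mult_left_cancel by blast
    moreover have "2 * a + real n = 2 * k + 1 + real n" "2 * a + 2 * real n + 1 = 2 * (k + 1 + real n)"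
      by (simp_all add: a_def)
    ultimately show ?thesis
      by (simp only:)
  qed
  let ?M = "angle_moment k x r"
  have "?M n = ?M 0 * S n \<and> ?M (Suc n) = ?M 0 * S (Suc n)"
  proof (induction n)
    case 0
    then show ?case
      using S0 S1 angle_moment_recurrence(1)[OF assms] by simp
  next
    case (Suc n)
    then have "(2 * k + 1 + real n) * ?M (Suc (Suc n)) = (2 * k + 1 + real n) * (?M 0 * S (Suc (Suc n)))"
      unfolding mult.left_commute[of "2 * k + 1 + real n" "?M 0"] S
      unfolding angle_moment_recurrence(2)[OF assms]
      by (simp add: algebra_simps)
    moreover have "2 * k + 1 + real n \<noteq> 0" using k by simp
    ultimately show ?case using Suc by simp
  qed
  then show ?thesis by (simp add: S_def T_def a_def)
qed

section \<open>An integral formula for the spherical mean\<close>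

definition chord :: "real \<Rightarrow> real \<Rightarrow> real \<Rightarrow> real" where
  "chord x r \<theta> = sqrt (chord_sq x r \<theta>)"

text \<open>
  Up to sign the cosine of the angle opposite to the side \<open>r\<close>. By the law of cosines the
  product with \<open>chord\<close> is the quantity \<open>(y\<^sup>2 + x\<^sup>2 - r\<^sup>2) / (2 x)\<close> that governs the odd moments.
\<close>

definition chord_cos :: "real \<Rightarrow> real \<Rightarrow> real \<Rightarrow> real" where
  "chord_cos x r \<theta> = (chord_sq x r \<theta> + x\<^sup>2 - r\<^sup>2) / (2 * x * chord x r \<theta>)"

text \<open>
  The conditional mean of \<open>f\<close> under \<open>\<sigma>\<close> at angle \<open>\<theta>\<close>: the point \<open>y\<close> has absolute value
  \<open>chord\<close>, and its sign is random with mean \<open>chord_cos\<close>.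
\<close>

definition reflected_mean :: "real \<Rightarrow> real \<Rightarrow> (real \<Rightarrow> real) \<Rightarrow> real \<Rightarrow> real" where
  "reflected_mean x r f \<theta> =
     ((1 + chord_cos x r \<theta>) * f (chord x r \<theta>) + (1 - chord_cos x r \<theta>) * f (- chord x r \<theta>)) / 2"

lemma chord_sq_bounds:
  assumes "r > 0"
  shows "(\<bar>x\<bar> - r)\<^sup>2 \<le> chord_sq x r \<theta>" and "chord_sq x r \<theta> \<le> (\<bar>x\<bar> + r)\<^sup>2"
proof -
  have "\<bar>x\<bar> * r * cos \<theta> \<le> \<bar>x\<bar> * r * 1" "\<bar>x\<bar> * r * (- 1) \<le> \<bar>x\<bar> * r * cos \<theta>"
    using assms cos_ge_minus_one[of \<theta>] by (intro mult_left_mono; simp)+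
  then show "(\<bar>x\<bar> - r)\<^sup>2 \<le> chord_sq x r \<theta>" "chord_sq x r \<theta> \<le> (\<bar>x\<bar> + r)\<^sup>2"
    by (auto simp: chord_sq_def power2_diff power2_sum mult_ac)
qed

lemma chord_facts:
  assumes "0 < r" and "r < \<bar>x\<bar>"
  shows "chord_sq x r \<theta> > 0" and "chord x r \<theta> > 0" and "(chord x r \<theta>)\<^sup>2 = chord_sq x r \<theta>"
    and "chord x r \<theta> \<le> \<bar>x\<bar> + r" and "\<bar>chord_cos x r \<theta>\<bar> \<le> 1"
proof -
  have "(\<bar>x\<bar> - r)\<^sup>2 > 0"
    using assms by simp
  then show v: "chord_sq x r \<theta> > 0"
    using chord_sq_bounds(1)[OF assms(1), of x \<theta>] by linarith
  then show z: "chord x r \<theta> > 0" and z2: "(chord x r \<theta>)\<^sup>2 = chord_sq x r \<theta>"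
    by (auto simp: chord_def)
  show "chord x r \<theta> \<le> \<bar>x\<bar> + r"
    using chord_sq_bounds(2)[OF assms(1), of x \<theta>] assms z2 by (metis abs_ge_zero add_nonneg_nonneg less_imp_le power2_le_imp_le)
  have "chord_sq x r \<theta> + x\<^sup>2 - r\<^sup>2 = 2 * \<bar>x\<bar> * (\<bar>x\<bar> + r * cos \<theta>)"
    by (simp add: chord_sq_def algebra_simps power2_eq_square)
  then have "\<bar>chord_cos x r \<theta>\<bar> = \<bar>\<bar>x\<bar> + r * cos \<theta>\<bar> / chord x r \<theta>"
    using assms z by (simp add: chord_cos_def abs_mult)
  moreover have "\<bar>\<bar>x\<bar> + r * cos \<theta>\<bar> \<le> chord x r \<theta>"
  proof (rule power2_le_imp_le)
    have "(r * cos \<theta>)\<^sup>2 \<le> r\<^sup>2 * 1"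
      unfolding power_mult_distrib by (intro mult_left_mono) (simp_all add: abs_square_le_1)
    then show "\<bar>\<bar>x\<bar> + r * cos \<theta>\<bar>\<^sup>2 \<le> (chord x r \<theta>)\<^sup>2"
      unfolding z2 by (simp add: chord_sq_def power2_sum)
  qed (use z in simp)
  ultimately show "\<bar>chord_cos x r \<theta>\<bar> \<le> 1"
    using z by simp
qed

lemma continuous_on_reflected_mean:
  assumes "0 < r" and "r < \<bar>x\<bar>" and "continuous_on UNIV f"
  shows "continuous_on S (reflected_mean x r f)"
proof -
  have z: "continuous_on S (chord x r)"
    unfolding chord_def by (intro continuous_intros continuous_on_chord_sq)
  have "continuous_on S (chord_cos x r)"
    unfolding chord_cos_def
    by (intro continuous_intros z continuous_on_chord_sq) (use chord_facts(2)[OF assms(1,2)] assms in \<open>auto simp: less_imp_neq[symmetric]\<close>)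
  then show ?thesis
    unfolding reflected_mean_def
    by (intro continuous_intros z continuous_on_compose2[OF assms(3)]) auto
qed

lemma integrable_reflected_mean:
  assumes "k > 1 / 2" and "0 < r" and "r < \<bar>x\<bar>" and "continuous_on UNIV f"
  shows "(\<lambda>\<theta>. reflected_mean x r f \<theta> * angle_weight k \<theta>) integrable_on {0..pi}"
  by (intro angle_weight_integrable continuous_on_reflected_mean assms)

lemma reflected_mean_bound:
  assumes "0 < r" and "r < \<bar>x\<bar>" and "\<And>y. \<bar>y\<bar> \<le> \<bar>x\<bar> + r \<Longrightarrow> \<bar>f y\<bar> \<le> e"
  shows "\<bar>reflected_mean x r f \<theta>\<bar> \<le> e"
proof -
  let ?s = "chord_cos x r \<theta>" and ?z = "chord x r \<theta>"
  have s: "0 \<le> 1 + ?s" "0 \<le> 1 - ?s" and z: "\<bar>?z\<bar> \<le> \<bar>x\<bar> + r" "\<bar>- ?z\<bar> \<le> \<bar>x\<bar> + r"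
    using chord_facts[OF assms(1,2), of \<theta>] by (auto simp: abs_le_iff)
  have "\<bar>(1 + ?s) * f ?z + (1 - ?s) * f (- ?z)\<bar> \<le> (1 + ?s) * \<bar>f ?z\<bar> + (1 - ?s) * \<bar>f (- ?z)\<bar>"
    using abs_triangle_ineq[of "(1 + ?s) * f ?z" "(1 - ?s) * f (- ?z)"] s by (simp add: abs_mult)
  also have "\<dots> \<le> (1 + ?s) * e + (1 - ?s) * e"
    by (intro add_mono mult_left_mono assms(3) z s)
  finally show ?thesis
    by (simp add: reflected_mean_def algebra_simps)
qed

lemma dunkl_sphere_support:
  assumes "dunkl_sphere_measure k V \<mu> x r M" and "r > 0"
  defines "S \<equiv> ({x - r..x + r} \<union> {- x - r..- x + r}) - {- \<bar>\<bar>x\<bar> - r\<bar><..<\<bar>\<bar>x\<bar> - r\<bar>}"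
  shows "borel_probability_supported_in M S" and "S \<in> sets borel" and "S \<subseteq> {- (\<bar>x\<bar> + r)..\<bar>x\<bar> + r}"
  using assms unfolding dunkl_sphere_measure_def by auto

text \<open>
  For even powers the sign is irrelevant and the even moments decide; for odd powers the factor
  \<open>chord_cos * chord\<close> produces the same combination of even moments as in the odd moments of \<open>\<sigma>\<close>.
\<close>

lemma dunkl_sphere_integral_monomial:
  assumes k: "k > 1 / 2" and "intertwining_operator k V" and "representing_measures V \<mu>"
    and "dunkl_sphere_measure k V \<mu> x r M" and r: "0 < r" "r < \<bar>x\<bar>"
  shows "integral {0..pi} (\<lambda>\<theta>. reflected_mean x r (\<lambda>y. y ^ n) \<theta> * angle_weight k \<theta>)
    = integral {0..pi} (angle_weight k) * (LINT y|M. y ^ n)"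
proof -
  have "k \<ge> 0" "x \<noteq> 0" using k r by auto
  note even = dunkl_sphere_even_moment[OF \<open>k \<ge> 0\<close> assms(2-4)]
  note odd = dunkl_sphere_odd_moment[OF \<open>k \<ge> 0\<close> assms(2-4)]
  have M0: "angle_moment k x r 0 = integral {0..pi} (angle_weight k)"
    by (simp add: angle_moment_def)
  have M: "angle_moment k x r m = integral {0..pi} (angle_weight k) * (LINT y|M. y ^ (2 * m))" for m
    unfolding even angle_moment_eq[OF k \<open>x \<noteq> 0\<close> r(1), of m] M0 ..
  have int: "((\<lambda>\<theta>. chord_sq x r \<theta> ^ m * angle_weight k \<theta>) has_integral angle_moment k x r m) {0..pi}" for m
    unfolding angle_moment_def
    by (intro integrable_integral angle_weight_integrable k continuous_intros continuous_on_chord_sq)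
  show ?thesis
  proof (cases "even n")
    case True
    then obtain m where n: "n = 2 * m" by blast
    have "reflected_mean x r (\<lambda>y. y ^ n) \<theta> = chord_sq x r \<theta> ^ m" for \<theta>
      unfolding reflected_mean_def n power_mult power2_minus chord_facts(3)[OF r]
      by (simp add: algebra_simps)
    then show ?thesis
      using M[of m] by (simp add: angle_moment_def n)
  next
    case False
    then obtain m where n: "n = Suc (2 * m)" using oddE by fastforce
    have "reflected_mean x r (\<lambda>y. y ^ n) \<theta> * angle_weight k \<theta>
        = (chord_sq x r \<theta> ^ Suc m * angle_weight k \<theta>
          + (x\<^sup>2 - r\<^sup>2) * (chord_sq x r \<theta> ^ m * angle_weight k \<theta>)) / (2 * x)" for \<theta>
    proof -
      have "reflected_mean x r (\<lambda>y. y ^ n) \<theta>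
          = chord_cos x r \<theta> * chord x r \<theta> * chord_sq x r \<theta> ^ m"
        unfolding reflected_mean_def n power_Suc power_mult power2_minus chord_facts(3)[OF r]
        by (simp add: field_simps)
      also have "chord_cos x r \<theta> * chord x r \<theta> = (chord_sq x r \<theta> + x\<^sup>2 - r\<^sup>2) / (2 * x)"
        using chord_facts(2)[OF r, of \<theta>] by (simp add: chord_cos_def)
      finally show ?thesis
        using \<open>x \<noteq> 0\<close> by (simp only:) (simp add: field_simps)
    qed
    moreover have "((\<lambda>\<theta>. (chord_sq x r \<theta> ^ Suc m * angle_weight k \<theta>
          + (x\<^sup>2 - r\<^sup>2) * (chord_sq x r \<theta> ^ m * angle_weight k \<theta>)) / (2 * x)) has_integral
        (angle_moment k x r (Suc m) + (x\<^sup>2 - r\<^sup>2) * angle_moment k x r m) / (2 * x)) {0..pi}"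
      by (intro has_integral_divide has_integral_add has_integral_mult_right int)
    ultimately have "integral {0..pi} (\<lambda>\<theta>. reflected_mean x r (\<lambda>y. y ^ n) \<theta> * angle_weight k \<theta>)
        = (angle_moment k x r (Suc m) + (x\<^sup>2 - r\<^sup>2) * angle_moment k x r m) / (2 * x)"
      by (simp only: integral_unique)
    also have "\<dots> = integral {0..pi} (angle_weight k) * (2 * x * (LINT y|M. y ^ n)) / (2 * x)"
      unfolding M n odd by (simp add: algebra_simps)
    finally show ?thesis
      using \<open>x \<noteq> 0\<close> by simp
  qed
qed

text \<open>
  An explicit form of the spherical mean (the rank-one product formula). It passes from polynomials to continuous
  functions by the Weierstrass theorem, because both sides are positive functionals that see \<open>f\<close>
  only on \<open>[-\<bar>x\<bar> - r, \<bar>x\<bar> + r]\<close>.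
\<close>

lemma dunkl_sphere_integral:
  assumes k: "k > 1 / 2" and "intertwining_operator k V" and "representing_measures V \<mu>"
    and M: "dunkl_sphere_measure k V \<mu> x r M" and r: "0 < r" "r < \<bar>x\<bar>"
    and f: "continuous_on UNIV f"
  shows "integral {0..pi} (\<lambda>\<theta>. reflected_mean x r f \<theta> * angle_weight k \<theta>)
    = integral {0..pi} (angle_weight k) * (LINT y|M. f y)"
proof -
  define N where "N = integral {0..pi} (angle_weight k)"
  define K where "K f = integral {0..pi} (\<lambda>\<theta>. reflected_mean x r f \<theta> * angle_weight k \<theta>)" for f
  define B where "B = \<bar>x\<bar> + r"
  note supp = dunkl_sphere_support[OF M r(1), folded B_def]
  note intM = integrable_continuous_compact_support[OF supp]
  interpret prob_space M
    using supp(1) by (simp add: borel_probability_supported_in_def)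
  have W: "angle_weight k integrable_on {0..pi}"
    by (intro integrable_continuous_interval continuous_on_angle_weight k)
  have N: "N \<ge> 0"
    unfolding N_def by (intro integral_nonneg W) (simp add: angle_weight_nonneg)
  have poly: "K (\<lambda>y. \<Sum>i\<le>n. a i * y ^ i) = N * (LINT y|M. (\<Sum>i\<le>n. a i * y ^ i))" for n and a :: "nat \<Rightarrow> real"
  proof -
    have "reflected_mean x r (\<lambda>y. \<Sum>i\<le>n. a i * y ^ i) \<theta> * angle_weight k \<theta>
        = (\<Sum>i\<le>n. a i * (reflected_mean x r (\<lambda>y. y ^ i) \<theta> * angle_weight k \<theta>))" for \<theta>
      unfolding reflected_mean_def sum_distrib_left sum_distrib_right sum.distrib[symmetric] sum_divide_distrib
      by (intro sum.cong refl) (simp add: algebra_simps)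
    moreover have "((\<lambda>\<theta>. \<Sum>i\<le>n. a i * (reflected_mean x r (\<lambda>y. y ^ i) \<theta> * angle_weight k \<theta>))
        has_integral (\<Sum>i\<le>n. a i * K (\<lambda>y. y ^ i))) {0..pi}"
      unfolding K_def
      by (intro has_integral_sum has_integral_mult_right integrable_integral
          integrable_reflected_mean k r continuous_intros finite_atMost)
    ultimately have "K (\<lambda>y. \<Sum>i\<le>n. a i * y ^ i) = (\<Sum>i\<le>n. a i * K (\<lambda>y. y ^ i))"
      by (simp add: K_def integral_unique)
    also have "\<dots> = (\<Sum>i\<le>n. a i * (N * (LINT y|M. y ^ i)))"
      by (simp add: K_def N_def dunkl_sphere_integral_monomial[OF k assms(2,3) M r])
    also have "\<dots> = N * (LINT y|M. (\<Sum>i\<le>n. a i * y ^ i))"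
      by (subst Bochner_Integration.integral_sum)
        (intro intM continuous_intros, simp add: sum_distrib_left mult_ac)
    finally show ?thesis .
  qed
  have "\<bar>K f - N * (LINT y|M. f y)\<bar> \<le> 0 + \<epsilon>" if "\<epsilon> > 0" for \<epsilon>
  proof -
    define e where "e = \<epsilon> / (2 * (N + 1))"
    have e: "e > 0" "2 * N * e \<le> \<epsilon>"
      using N that by (auto simp: e_def field_simps)
    obtain g where "real_polynomial_function g" and g: "\<And>y. y \<in> {- B..B} \<Longrightarrow> \<bar>f y - g y\<bar> < e"
      using Stone_Weierstrass_real_polynomial_function[of "{- B..B}" f e,
            OF compact_Icc continuous_on_subset[OF f subset_UNIV] e(1)] by blast
    then obtain a n where ga: "g = (\<lambda>y. \<Sum>i\<le>n. a i * y ^ i)"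
      using real_polynomial_function_iff_sum by auto
    have gc: "continuous_on UNIV g"
      unfolding ga by (intro continuous_intros)
    have "\<bar>K f - K g\<bar> \<le> N * e"
    proof -
      have "reflected_mean x r (\<lambda>y. f y - g y) \<theta> * angle_weight k \<theta>
          = reflected_mean x r f \<theta> * angle_weight k \<theta> - reflected_mean x r g \<theta> * angle_weight k \<theta>" for \<theta>
        by (simp add: reflected_mean_def field_simps)
      then have "K f - K g = integral {0..pi} (\<lambda>\<theta>. reflected_mean x r (\<lambda>y. f y - g y) \<theta> * angle_weight k \<theta>)"
        unfolding K_def by (simp only:) (intro integral_diff[symmetric] integrable_reflected_mean k r f gc)
      also have "norm \<dots> \<le> integral {0..pi} (\<lambda>\<theta>. e * angle_weight k \<theta>)"
      proof (rule integral_norm_bound_integral)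
        show "(\<lambda>\<theta>. reflected_mean x r (\<lambda>y. f y - g y) \<theta> * angle_weight k \<theta>) integrable_on {0..pi}"
          by (intro integrable_reflected_mean k r continuous_intros f gc)
        have "\<bar>f y - g y\<bar> \<le> e" if "\<bar>y\<bar> \<le> \<bar>x\<bar> + r" for y
          using g[of y] that by (auto simp: B_def abs_le_iff abs_less_iff)
        then show "norm (reflected_mean x r (\<lambda>y. f y - g y) \<theta> * angle_weight k \<theta>) \<le> e * angle_weight k \<theta>" for \<theta>
          using mult_right_mono[OF reflected_mean_bound[OF r, of "\<lambda>y. f y - g y" e \<theta>]
              angle_weight_nonneg[of k \<theta>]] angle_weight_nonneg[of k \<theta>]
          by (simp add: abs_mult)
      qed (intro integrable_on_mult_right W)
      finally show ?thesis by (simp add: N_def mult.commute)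
    qed
    moreover have "\<bar>N * (LINT y|M. f y) - K g\<bar> \<le> N * e"
    proof -
      have "(LINT y|M. f y) - (LINT y|M. g y) = (LINT y|M. f y - g y)"
        by (intro Bochner_Integration.integral_diff[symmetric] intM f gc)
      also have "\<bar>\<dots>\<bar> \<le> (LINT y|M. \<bar>f y - g y\<bar>)"
        by (rule integral_abs_bound)
      also have "\<dots> \<le> (LINT y|M. e)"
        using AE_compact_support[OF supp] g
        by (intro integral_mono_AE intM continuous_intros f gc) (auto intro: less_imp_le)
      finally have "\<bar>(LINT y|M. f y) - (LINT y|M. g y)\<bar> \<le> e"
        by (simp add: prob_space)
      then have "N * \<bar>(LINT y|M. f y) - (LINT y|M. g y)\<bar> \<le> N * e"
        using N by (intro mult_left_mono)
      moreover have "K g = N * (LINT y|M. g y)"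
        unfolding ga by (rule poly)
      ultimately show ?thesis
        using N by (simp only: right_diff_distrib[symmetric] abs_mult abs_of_nonneg)
    qed
    ultimately show ?thesis using e by linarith
  qed
  then have "\<bar>K f - N * (LINT y|M. f y)\<bar> \<le> 0"
    by (rule field_le_epsilon)
  then show ?thesis by (simp add: K_def N_def)
qed

section \<open>A harmonic function with one kink\<close>

text \<open>
  The Dunkl-harmonic functions on a pair of intervals symmetric about \<open>0\<close> and not containing it are the combinations of
  \<open>1\<close>, \<open>t\<close>, \<open>\<bar>t\<bar>\<^sup>1\<^sup>-\<^sup>2\<^sup>k\<close> and \<open>sgn t \<bar>t\<bar>\<^sup>-\<^sup>2\<^sup>k\<close>. Up to a factor there is exactly one combination that
  vanishes at \<open>1\<close> together with its first two derivatives. Its values at \<open>t\<close> and at \<open>-t\<close>, for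
  \<open>t > 0\<close>, are given by \<open>s = 1\<close> and \<open>s = -1\<close>.
\<close>

definition outer_branch :: "real \<Rightarrow> real \<Rightarrow> real \<Rightarrow> real" where
  "outer_branch k s t = s * (2 * k - 1) * t - (2 * k + 1) + ((2 * k + 1) * t - s * (2 * k - 1)) * t powr (- 2 * k)"

definition outer_branch_d1 :: "real \<Rightarrow> real \<Rightarrow> real \<Rightarrow> real" where
  "outer_branch_d1 k s t = s * (2 * k - 1) - (2 * k + 1) * (2 * k - 1) * t powr (- 2 * k)
     + s * (2 * k) * (2 * k - 1) * (t powr (- 2 * k) / t)"

definition outer_branch_d2 :: "real \<Rightarrow> real \<Rightarrow> real \<Rightarrow> real" where
  "outer_branch_d2 k s t = 2 * k * (2 * k - 1) * (2 * k + 1) * (t powr (- 2 * k) / t) * (1 - s / t)"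

lemma has_real_derivative_powr_quotient:
  fixes a :: real
  assumes "t > 0"
  shows "((\<lambda>t. t powr a) has_real_derivative a * (t powr a / t)) (at t)"
  using has_real_derivative_powr[OF assms, of a] assms by (simp add: powr_diff)

lemma outer_branch_derivs:
  assumes "t > 0"
  shows "(outer_branch k s has_real_derivative outer_branch_d1 k s t) (at t)"
    and "(outer_branch_d1 k s has_real_derivative outer_branch_d2 k s t) (at t)"
proof -
  have P: "((\<lambda>t. t powr (- 2 * k)) has_real_derivative - 2 * k * (t powr (- 2 * k) / t)) (at t)"
    by (rule has_real_derivative_powr_quotient[OF assms])
  have "((\<lambda>t. s * (2 * k - 1) * t - (2 * k + 1) + ((2 * k + 1) * t - s * (2 * k - 1)) * P t)
        has_real_derivative s * (2 * k - 1) - (2 * k + 1) * (2 * k - 1) * P t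
          + s * (2 * k) * (2 * k - 1) * (P t / t)) (at t)"
    and "((\<lambda>t. s * (2 * k - 1) - (2 * k + 1) * (2 * k - 1) * P t + s * (2 * k) * (2 * k - 1) * (P t / t))
        has_real_derivative 2 * k * (2 * k - 1) * (2 * k + 1) * (P t / t) * (1 - s / t)) (at t)"
    if "(P has_real_derivative - 2 * k * (P t / t)) (at t)" for P
    using assms that by (auto intro!: derivative_eq_intros simp: field_simps power2_eq_square)
  from this[OF P] show "(outer_branch k s has_real_derivative outer_branch_d1 k s t) (at t)"
    and "(outer_branch_d1 k s has_real_derivative outer_branch_d2 k s t) (at t)"
    unfolding outer_branch_def outer_branch_d1_def outer_branch_d2_def .
qed

lemma outer_branch_at_1: "outer_branch k 1 1 = 0" "outer_branch_d1 k 1 1 = 0" "outer_branch_d2 k 1 1 = 0" "outer_branch k (- 1) 1 = 0"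
  by (auto simp: outer_branch_def outer_branch_d1_def outer_branch_d2_def algebra_simps)

text \<open>
  A function with vanishing derivative at \<open>1\<close> may be continued by a constant to the left of \<open>1\<close>
  without losing differentiability. Applied to the outer branch and to its derivative, this glues
  it to zero.
\<close>

lemma has_real_derivative_max_1:
  fixes f :: "real \<Rightarrow> real"
  assumes f: "\<And>t. t \<ge> 1 \<Longrightarrow> (f has_real_derivative f' t) (at t)" and "f' 1 = 0"
  shows "((\<lambda>t. f (max 1 t)) has_real_derivative f' (max 1 t)) (at t)"
proof -
  consider "t < 1" | "t = 1" | "t > 1" by linarith
  then show ?thesis
  proof cases
    case 1
    have "((\<lambda>t. f 1) has_real_derivative f' (max 1 t)) (at t)"
      using 1 assms(2) by simp
    then show ?thesis
      by (rule has_field_derivative_transform_within_open[of _ _ _ "{..<1}"]) (use 1 in auto)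
  next
    case 3
    then have "(f has_real_derivative f' (max 1 t)) (at t)"
      using f[of t] by simp
    then show ?thesis
      by (rule has_field_derivative_transform_within_open[of _ _ _ "{1<..}"]) (use 3 in auto)
  next
    case 2
    have "((\<lambda>s. (f s - f 1) / (s - 1)) \<longlongrightarrow> 0) (at 1)"
      using f[of 1] assms(2) by (simp add: has_field_derivative_iff)
    then have "((\<lambda>s. norm ((f s - f 1) / (s - 1))) \<longlongrightarrow> 0) (at 1)"
      by (rule tendsto_norm_zero)
    moreover have "\<forall>\<^sub>F s in at 1. norm ((f (max 1 s) - f 1) / (s - 1)) \<le> norm ((f s - f 1) / (s - 1))"
      by (intro always_eventually) (auto simp: max_def)
    ultimately have "((\<lambda>s. (f (max 1 s) - f 1) / (s - 1)) \<longlongrightarrow> 0) (at 1)"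
      by (rule Lim_null_comparison[rotated])
    then show ?thesis
      using 2 assms(2) by (simp add: has_field_derivative_iff)
  qed
qed

text \<open>
  Zero on \<open>[-1, 1]\<close>, and the outer branch beyond. At \<open>1\<close> the two pieces fit together twice continuously
  differentiably, at \<open>-1\<close> they are only continuous. The functions \<open>kink_d1\<close> and \<open>kink_d2\<close> are the
  derivatives away from \<open>-1\<close>.
\<close>

definition kink :: "real \<Rightarrow> real \<Rightarrow> real" where
  "kink k t = outer_branch k 1 (max 1 t) + outer_branch k (- 1) (max 1 (- t))"

definition kink_d1 :: "real \<Rightarrow> real \<Rightarrow> real" where
  "kink_d1 k t = outer_branch_d1 k 1 (max 1 t) - (if t < - 1 then outer_branch_d1 k (- 1) (- t) else 0)"

definition kink_d2 :: "real \<Rightarrow> real \<Rightarrow> real" where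
  "kink_d2 k t = outer_branch_d2 k 1 (max 1 t) + (if t < - 1 then outer_branch_d2 k (- 1) (- t) else 0)"

lemma kink_derivs:
  assumes "t \<noteq> - 1"
  shows "(kink k has_real_derivative kink_d1 k t) (at t)"
    and "(kink_d1 k has_real_derivative kink_d2 k t) (at t)"
    and "isCont (kink_d2 k) t"
proof -
  have p: "((\<lambda>t. outer_branch k 1 (max 1 t)) has_real_derivative outer_branch_d1 k 1 (max 1 t)) (at t)"
    and p1: "((\<lambda>t. outer_branch_d1 k 1 (max 1 t)) has_real_derivative outer_branch_d2 k 1 (max 1 t)) (at t)"
    by (intro has_real_derivative_max_1 outer_branch_derivs outer_branch_at_1; simp)+
  have p2: "isCont (\<lambda>t. outer_branch_d2 k 1 (max 1 t)) t"
    unfolding outer_branch_d2_def by (intro continuous_intros) auto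
  have "(kink k has_real_derivative kink_d1 k t) (at t) \<and> (kink_d1 k has_real_derivative kink_d2 k t) (at t)
    \<and> isCont (kink_d2 k) t"
  proof (cases "t < - 1")
    case True
    have *: "- s \<noteq> 0" "- s > 0" "max 1 (- s) = - s" if "s \<in> {..<- 1}" for s :: real
      using that by auto
    have q: "((\<lambda>s. outer_branch k (- 1) (- s)) has_real_derivative - outer_branch_d1 k (- 1) (- t)) (at t)"
      and q1: "((\<lambda>s. - outer_branch_d1 k (- 1) (- s)) has_real_derivative outer_branch_d2 k (- 1) (- t)) (at t)"
      using outer_branch_derivs[of "- t" k "- 1"] DERIV_minus True by (fastforce simp: DERIV_mirror)+
    have "isCont (\<lambda>s. outer_branch_d2 k (- 1) (- s)) t"
      unfolding outer_branch_d2_def using True by (intro continuous_intros) auto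
    then have "isCont (\<lambda>s. outer_branch_d2 k 1 (max 1 s) + outer_branch_d2 k (- 1) (- s)) t"
      by (intro continuous_intros p2)
    moreover have "\<forall>\<^sub>F s in nhds t. outer_branch_d2 k 1 (max 1 s) + outer_branch_d2 k (- 1) (- s) = kink_d2 k s"
      by (rule eventually_nhds_in_open[of "{..<- 1}", THEN eventually_mono])
        (use True in \<open>auto simp: kink_d2_def\<close>)
    ultimately have "isCont (kink_d2 k) t"
      by (rule iffD1[OF isCont_cong, rotated])
    moreover have "(kink k has_real_derivative kink_d1 k t) (at t)"
      by (rule has_field_derivative_transform_within_open[of "\<lambda>s. outer_branch k 1 (max 1 s) + outer_branch k (- 1) (- s)"
            _ _ "{..<- 1}"])
        (use True * p q in \<open>auto simp: kink_def kink_d1_def intro!: derivative_eq_intros\<close>)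
    moreover have "(kink_d1 k has_real_derivative kink_d2 k t) (at t)"
      by (rule has_field_derivative_transform_within_open[of "\<lambda>s. outer_branch_d1 k 1 (max 1 s) + - outer_branch_d1 k (- 1) (- s)"
            _ _ "{..<- 1}"])
        (use True p1 DERIV_add[OF p1 q1] in \<open>auto simp: kink_d1_def kink_d2_def\<close>)
    ultimately show ?thesis by blast
  next
    case False
    then have t: "t \<in> {- 1<..}" using assms by auto
    have "\<forall>\<^sub>F s in nhds t. outer_branch_d2 k 1 (max 1 s) = kink_d2 k s"
      by (rule eventually_nhds_in_open[of "{- 1<..}", THEN eventually_mono])
        (use t in \<open>auto simp: kink_d2_def\<close>)
    then have "isCont (kink_d2 k) t"
      by (rule iffD1[OF isCont_cong]) (rule p2)
    moreover have "(kink k has_real_derivative kink_d1 k t) (at t)"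
      by (rule has_field_derivative_transform_within_open[of "\<lambda>s. outer_branch k 1 (max 1 s)" _ _ "{- 1<..}"])
        (use t p outer_branch_at_1 in \<open>auto simp: kink_def kink_d1_def max_def\<close>)
    moreover have "(kink_d1 k has_real_derivative kink_d2 k t) (at t)"
      by (rule has_field_derivative_transform_within_open[of "\<lambda>s. outer_branch_d1 k 1 (max 1 s)" _ _ "{- 1<..}"])
        (use t p1 in \<open>auto simp: kink_d1_def kink_d2_def\<close>)
    ultimately show ?thesis by blast
  qed
  then show "(kink k has_real_derivative kink_d1 k t) (at t)"
    and "(kink_d1 k has_real_derivative kink_d2 k t) (at t)"
    and "isCont (kink_d2 k) t" by auto
qed

lemma continuous_on_kink: "continuous_on S (kink k)"
  unfolding kink_def outer_branch_def by (intro continuous_intros) auto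

lemma kink_zero:
  assumes "- 1 \<le> t" and "t \<le> 1"
  shows "kink k t = 0" and "kink_d1 k t = 0" and "kink_d2 k t = 0"
  using assms outer_branch_at_1 by (auto simp: kink_def kink_d1_def kink_d2_def max_def)

text \<open>
  At \<open>t = 1\<close> the reflection term involves the value at \<open>-1\<close>, and continuity there makes it vanish.
\<close>

lemma kink_dunkl_equation:
  assumes "t \<noteq> - 1"
  shows "kink_d2 k t + (2 * k / t) * kink_d1 k t - k * ((kink k t - kink k (- t)) / t\<^sup>2) = 0"
proof -
  consider "\<bar>t\<bar> \<le> 1" | "t > 1" | "t < - 1" by linarith
  then show ?thesis
  proof cases
    case 1
    then show ?thesis using kink_zero[of t k] kink_zero[of "- t" k] by auto
  next
    case 2
    then show ?thesis
      using outer_branch_at_1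
      by (simp add: kink_def kink_d1_def kink_d2_def max_def outer_branch_def outer_branch_d1_def outer_branch_d2_def)
        (simp add: field_simps power2_eq_square)
  next
    case 3
    define u where "u = - t"
    then have "t = - u" "u > 1" using 3 by auto
    then show ?thesis
      using outer_branch_at_1
      by (simp add: kink_def kink_d1_def kink_d2_def max_def outer_branch_def outer_branch_d1_def outer_branch_d2_def)
        (simp add: field_simps power2_eq_square)
  qed
qed

text \<open>
  Harmonicity survives scaling and reflection, so that the singular point can be any \<open>-c \<noteq> 0\<close>.
  At the origin the Laplacian is a limit of values that all vanish.
\<close>

lemma dunkl_harmonic_kink:
  assumes c: "c \<noteq> 0"
  shows "dunkl_harmonic_on k (\<lambda>y. kink k (y / c)) (- {- c})"
proof -
  let ?h = "\<lambda>y. kink k (y / c)"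
  have ne: "y / c \<noteq> - 1 \<longleftrightarrow> y \<noteq> - c" for y
    using c by (auto simp: field_simps)
  have h: "(?h has_real_derivative kink_d1 k (y / c) / c) (at y)"
    and h1: "((\<lambda>y. kink_d1 k (y / c) / c) has_real_derivative kink_d2 k (y / c) / c\<^sup>2) (at y)"
    if "y \<noteq> - c" for y
  proof -
    have "((\<lambda>y. y / c) has_real_derivative 1 / c) (at y)"
      using c by (auto intro!: derivative_eq_intros)
    note chain = DERIV_chain2[OF _ this] and ne' = ne[of y, THEN iffD2, OF that]
    show "(?h has_real_derivative kink_d1 k (y / c) / c) (at y)"
      using chain[OF kink_derivs(1)[OF ne', of k]] by simp
    show "((\<lambda>y. kink_d1 k (y / c) / c) has_real_derivative kink_d2 k (y / c) / c\<^sup>2) (at y)"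
      using DERIV_cdivide[OF chain[OF kink_derivs(2)[OF ne', of k]], of c] by (simp add: power2_eq_square)
  qed
  have d: "deriv ?h y = kink_d1 k (y / c) / c" if "y \<noteq> - c" for y
    using h[OF that] by (rule DERIV_imp_deriv)
  have d1: "(deriv ?h has_real_derivative kink_d2 k (y / c) / c\<^sup>2) (at y)" if "y \<noteq> - c" for y
    by (rule has_field_derivative_transform_within_open[OF h1[OF that], of "- {- c}"])
      (use that d in auto)
  have d2: "deriv (deriv ?h) y = kink_d2 k (y / c) / c\<^sup>2" if "y \<noteq> - c" for y
    using d1[OF that] by (rule DERIV_imp_deriv)
  have "continuous_on (- {- c}) (\<lambda>y. kink_d2 k (y / c) / c\<^sup>2)"
  proof (intro continuous_at_imp_continuous_on ballI)
    fix y assume "y \<in> - {- c}"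
    then have "isCont (kink_d2 k) (y / c)"
      using ne[of y] by (intro kink_derivs) auto
    moreover have "isCont (\<lambda>y. y / c) y"
      using c by (intro continuous_intros)
    ultimately have "isCont (\<lambda>y. kink_d2 k (y / c)) y"
      by (rule isCont_o2[rotated])
    then show "isCont (\<lambda>y. kink_d2 k (y / c) / c\<^sup>2) y"
      using c by (intro continuous_intros) auto
  qed
  then have "continuous_on (- {- c}) (deriv (deriv ?h))"
    by (rule continuous_on_eq) (simp add: d2)
  then have "C2_on ?h (- {- c})"
    using h d1 by (auto simp: C2_on_def field_differentiable_def)
  moreover have "dunkl_laplacian k ?h y = 0" if "y \<in> - {- c}" for y
  proof -
    define L where "L y = deriv (deriv ?h) y + (2 * k / y) * deriv ?h y
        - k * ((?h y - ?h (- y)) / y\<^sup>2)" for y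
    have L: "L y = 0" if "y \<noteq> - c" for y
    proof -
      have "L y = (kink_d2 k (y / c) + (2 * k / (y / c)) * kink_d1 k (y / c)
          - k * ((kink k (y / c) - kink k (- (y / c))) / (y / c)\<^sup>2)) / c\<^sup>2"
        using that c unfolding L_def d[OF that] d2[OF that]
        by (simp add: field_simps power2_eq_square)
      then show ?thesis
        unfolding kink_dunkl_equation[OF ne[THEN iffD2, OF that]] by simp
    qed
    have "Lim (at 0) L = 0"
    proof (rule tendsto_Lim)
      have "\<forall>\<^sub>F y in at 0. L y = 0"
        using eventually_neq_at_within[of "- c" 0 UNIV] by (rule eventually_mono) (rule L)
      then show "(L \<longlongrightarrow> 0) (at 0)"
        by (rule tendsto_eventually)
    qed simp
    then show ?thesis
      using L that by (auto simp: dunkl_laplacian_def L_def[abs_def] Let_def)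
  qed
  ultimately show ?thesis
    by (simp add: dunkl_harmonic_on_def)
qed

text \<open>
  The triple zero at \<open>1\<close>: the second derivative is at most linear, and two integrations follow.
\<close>

lemma outer_branch_cubic_bound:
  assumes k: "k > 1 / 2" and t: "t \<ge> 1"
  shows "outer_branch k 1 t \<le> 2 * k * (2 * k - 1) * (2 * k + 1) * (t - 1) ^ 3"
proof -
  define L where "L = 2 * k * (2 * k - 1) * (2 * k + 1)"
  have L: "L \<ge> 0" using k by (simp add: L_def)
  have p2: "outer_branch_d2 k 1 u \<le> L * (u - 1)" if "u \<ge> 1" for u
  proof -
    have "u powr (- 2 * k) \<le> 1"
      using that k powr_mono[of "- 2 * k" 0 u] by simp
    moreover have "1 \<le> u * u"
      using that mult_mono[of 1 u 1 u] by simp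
    ultimately have "u powr (- 2 * k) / (u * u) \<le> 1"
      using that by (simp add: divide_le_eq)
    then have "L * (u - 1) * (u powr (- 2 * k) / (u * u)) \<le> L * (u - 1) * 1"
      using L that by (intro mult_left_mono) auto
    moreover have "outer_branch_d2 k 1 u = L * (u - 1) * (u powr (- 2 * k) / (u * u))"
      using that by (simp add: outer_branch_d2_def L_def field_simps)
    ultimately show ?thesis by simp
  qed
  have p1: "outer_branch_d1 k 1 u \<le> L * (u - 1)\<^sup>2" if u: "u \<ge> 1" for u
  proof -
    have "L * (1 - 1)\<^sup>2 - outer_branch_d1 k 1 1 \<le> L * (u - 1)\<^sup>2 - outer_branch_d1 k 1 u"
    proof (rule DERIV_nonneg_imp_nondecreasing[OF u])
      fix v assume v: "1 \<le> v" "v \<le> u"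
      have "((\<lambda>v. L * (v - 1)\<^sup>2 - outer_branch_d1 k 1 v) has_real_derivative 2 * (L * (v - 1)) - outer_branch_d2 k 1 v) (at v)"
        using v by (auto intro!: derivative_eq_intros outer_branch_derivs)
      moreover have "2 * (L * (v - 1)) - outer_branch_d2 k 1 v \<ge> 0"
      proof -
        have "L * (v - 1) \<ge> 0" using L v by simp
        then show ?thesis using p2[of v] v by linarith
      qed
      ultimately show "\<exists>y. ((\<lambda>v. L * (v - 1)\<^sup>2 - outer_branch_d1 k 1 v) has_real_derivative y) (at v) \<and> 0 \<le> y"
        by blast
    qed
    then show ?thesis using outer_branch_at_1 by simp
  qed
  have "L * (1 - 1) ^ 3 - outer_branch k 1 1 \<le> L * (t - 1) ^ 3 - outer_branch k 1 t"
  proof (rule DERIV_nonneg_imp_nondecreasing[OF t])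
    fix v assume v: "1 \<le> v" "v \<le> t"
    have "((\<lambda>v. L * (v - 1) ^ 3 - outer_branch k 1 v) has_real_derivative 3 * (L * (v - 1)\<^sup>2) - outer_branch_d1 k 1 v) (at v)"
      using v by (auto intro!: derivative_eq_intros outer_branch_derivs)
    moreover have "3 * (L * (v - 1)\<^sup>2) - outer_branch_d1 k 1 v \<ge> 0"
    proof -
      have "L * (v - 1)\<^sup>2 \<ge> 0" using L by simp
      then show ?thesis using p1[of v] v by linarith
    qed
    ultimately show "\<exists>y. ((\<lambda>v. L * (v - 1) ^ 3 - outer_branch k 1 v) has_real_derivative y) (at v) \<and> 0 \<le> y"
      by blast
  qed
  then show ?thesis using outer_branch_at_1 by (simp add: L_def)
qed

lemma outer_branch_reflected_bound:
  assumes k: "k > 1 / 2" and t: "t \<ge> 1"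
  shows "outer_branch k (- 1) t \<le> - (2 * k - 1) * (t - 1)"
proof -
  have "t powr (- 2 * k) \<le> 1" "t powr (1 - 2 * k) \<le> 1"
    using t k powr_mono[of "- 2 * k" 0 t] powr_mono[of "1 - 2 * k" 0 t] by auto
  moreover have "t powr (1 - 2 * k) = t * t powr (- 2 * k)"
    using t by (simp add: powr_diff powr_minus_divide)
  ultimately have "(2 * k + 1) * (t * t powr (- 2 * k)) \<le> (2 * k + 1) * 1"
    "(2 * k - 1) * t powr (- 2 * k) \<le> (2 * k - 1) * 1"
    using k by (intro mult_left_mono; simp)+
  then show ?thesis
    by (simp add: outer_branch_def algebra_simps)
qed

section \<open>Negativity of a spherical mean\<close>

text \<open>
  For suitable parameters the chord exceeds the length \<open>1\<close> exactly at those angles where \<open>cap\<close> is positive,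
  and the excess of its square is there a multiple of \<open>cap\<close>. The parameter \<open>w\<close> measures the size of the
  spherical cap of these angles.
\<close>

definition cap :: "real \<Rightarrow> real \<Rightarrow> real" where
  "cap w \<theta> = max 0 (w - (1 - cos \<theta>))"

lemma continuous_on_cap: "continuous_on S (cap w)"
  unfolding cap_def by (intro continuous_intros)

text \<open>
  Near the tip \<open>\<theta> = 0\<close> the direct part of the mean is governed by \<open>cap\<^sup>3\<close>, the reflected part by
  \<open>(1 - cos \<theta>) cap\<close>. Pointwise neither dominates, but integration by parts trades one power of
  \<open>cap\<close> for \<open>sin\<^sup>2 \<theta> \<le> 2 (1 - cos \<theta>)\<close>, and a second one is at most \<open>w\<close>: on small caps the direct
  part is negligible.
\<close>

lemma cap_cubed_integral_le:
  assumes k: "k > 1 / 2" and w: "0 < w" "w \<le> 1 / 2"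
  shows "k * integral {0..pi} (\<lambda>\<theta>. cap w \<theta> ^ 3 * angle_weight k \<theta>)
    \<le> 6 * w * integral {0..pi} (\<lambda>\<theta>. (1 - cos \<theta>) * cap w \<theta> * angle_weight k \<theta>)"
proof -
  let ?W = "angle_weight k"
  have deriv: "((\<lambda>\<theta>. cap w \<theta> ^ 3) has_real_derivative - (3 * (cap w \<theta>)\<^sup>2 * sin \<theta>)) (at \<theta>)" for \<theta>
  proof -
    have "((\<lambda>t. (max 1 t - 1) ^ 3) has_real_derivative 3 * (max 1 t - 1)\<^sup>2) (at t)" for t :: real
      by (rule has_real_derivative_max_1) (auto intro!: derivative_eq_intros)
    moreover have "((\<lambda>\<theta>. w + cos \<theta>) has_real_derivative - sin \<theta>) (at \<theta>)"
      by (auto intro!: derivative_eq_intros)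
    ultimately have "((\<lambda>\<theta>. (max 1 (w + cos \<theta>) - 1) ^ 3) has_real_derivative
        3 * (max 1 (w + cos \<theta>) - 1)\<^sup>2 * (- sin \<theta>)) (at \<theta>)"
      by (rule DERIV_chain2)
    moreover have "max 1 (w + cos \<theta>) - 1 = cap w \<theta>" for \<theta>
      by (simp add: cap_def max_def)
    ultimately show ?thesis by simp
  qed
  have parts: "((\<lambda>\<theta>. (2 * k * cos \<theta> * cap w \<theta> ^ 3 + sin \<theta> * - (3 * (cap w \<theta>)\<^sup>2 * sin \<theta>)) * ?W \<theta>)
      has_integral 0) {0..pi}"
    by (intro integral_angle_weight_by_parts k deriv continuous_intros continuous_on_cap)
  have diff: "((\<lambda>\<theta>. k * (cap w \<theta> ^ 3 * ?W \<theta>) - 6 * w * ((1 - cos \<theta>) * cap w \<theta> * ?W \<theta>)) has_integral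
      k * integral {0..pi} (\<lambda>\<theta>. cap w \<theta> ^ 3 * ?W \<theta>)
      - 6 * w * integral {0..pi} (\<lambda>\<theta>. (1 - cos \<theta>) * cap w \<theta> * ?W \<theta>)) {0..pi}"
    by (intro has_integral_diff has_integral_mult_right integrable_integral angle_weight_integrable k
        continuous_intros continuous_on_cap)
  have "k * integral {0..pi} (\<lambda>\<theta>. cap w \<theta> ^ 3 * ?W \<theta>)
      - 6 * w * integral {0..pi} (\<lambda>\<theta>. (1 - cos \<theta>) * cap w \<theta> * ?W \<theta>) \<le> 0"
  proof (rule has_integral_le[OF diff parts])
    fix \<theta> :: real
    define y where "y = cap w \<theta>"
    define v where "v = 1 - cos \<theta>"
    have v: "0 \<le> v" by (simp add: v_def)
    have sin: "(sin \<theta>)\<^sup>2 = v * (2 - v)"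
      by (simp add: v_def sin_squared_eq algebra_simps power2_eq_square)
    have "k * y ^ 3 - 6 * w * (v * y) \<le> 2 * k * (1 - v) * y ^ 3 - 3 * y\<^sup>2 * (v * (2 - v))"
    proof (cases "v < w")
      case True
      then have y: "0 \<le> y" "y \<le> w"
        using v by (auto simp: y_def cap_def v_def)
      have "k * y ^ 3 * 1 \<le> k * y ^ 3 * (2 * (1 - v))"
        using True w k y by (intro mult_left_mono) auto
      moreover have "y * (v * (2 - v)) \<le> w * (v * 2)"
        using y v True w by (intro mult_mono) auto
      then have "3 * y * (y * (v * (2 - v))) \<le> 3 * y * (w * (v * 2))"
        using y by (intro mult_left_mono) auto
      ultimately show ?thesis
        by (simp add: algebra_simps power2_eq_square)
    next
      case False
      then have "y = 0" by (simp add: y_def cap_def v_def)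
      then show ?thesis by simp
    qed
    then have "(k * y ^ 3 - 6 * w * (v * y)) * ?W \<theta> \<le> (2 * k * (1 - v) * y ^ 3 - 3 * y\<^sup>2 * (sin \<theta>)\<^sup>2) * ?W \<theta>"
      unfolding sin by (intro mult_right_mono angle_weight_nonneg)
    then show "k * (cap w \<theta> ^ 3 * ?W \<theta>) - 6 * w * ((1 - cos \<theta>) * cap w \<theta> * ?W \<theta>)
        \<le> (2 * k * cos \<theta> * cap w \<theta> ^ 3 + sin \<theta> * - (3 * (cap w \<theta>)\<^sup>2 * sin \<theta>)) * ?W \<theta>"
      by (simp add: y_def v_def algebra_simps power2_eq_square)
  qed
  then show ?thesis by simp
qed

lemma cap_integral_pos:
  assumes k: "k > 1 / 2" and w: "0 < w" "w \<le> 1 / 2"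
  shows "integral {0..pi} (\<lambda>\<theta>. (1 - cos \<theta>) * cap w \<theta> * angle_weight k \<theta>) > 0"
proof -
  let ?f = "\<lambda>\<theta>. (1 - cos \<theta>) * cap w \<theta> * angle_weight k \<theta>"
  have cont: "continuous_on {0..pi} ?f"
    by (intro continuous_intros continuous_on_cap continuous_on_angle_weight k)
  then have int: "?f integrable_on {0..pi}"
    by (rule integrable_continuous_interval)
  have nonneg: "?f \<theta> \<ge> 0" for \<theta>
    by (simp add: cap_def angle_weight_nonneg)
  define \<theta> where "\<theta> = arccos (1 - w / 2)"
  have \<theta>: "cos \<theta> = 1 - w / 2" "0 < \<theta>" "\<theta> < pi"
    using w arccos_lt_bounded[of "1 - w / 2"] by (auto simp: \<theta>_def)
  have "integral {0..pi} ?f \<noteq> 0"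
  proof
    assume "integral {0..pi} ?f = 0"
    then have "(?f has_integral 0) (cbox 0 pi)"
      using integrable_integral[OF int] by simp
    then have "?f \<theta> = 0"
      using \<theta> by (intro has_integral_0_cbox_imp_0[of 0 pi ?f \<theta>]) (use cont nonneg in auto)
    moreover have "cap w \<theta> > 0" "angle_weight k \<theta> > 0"
      using \<theta> w sin_gt_zero[of \<theta>] by (auto simp: cap_def angle_weight_def)
    ultimately show False
      using \<theta> w by simp
  qed
  moreover have "integral {0..pi} ?f \<ge> 0"
    by (intro integral_nonneg int nonneg)
  ultimately show ?thesis by simp
qed

text \<open>
  The hypothesis on \<open>\<xi>\<close> says that the chord has length \<open>1\<close> where \<open>1 - cos \<theta> = w\<close>. On the cap the direct
  point carries a value bounded by a multiple of \<open>(\<rho> cap)\<^sup>3\<close>. The reflected point has only probability of order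
  \<open>\<rho>\<^sup>2 sin\<^sup>2 \<theta>\<close> but carries a negative value of order \<open>\<rho> cap\<close>. Both contributions are of order
  \<open>\<rho>\<^sup>3\<close>, so that their ratio depends on \<open>w\<close> alone.
\<close>

lemma reflected_mean_kink_le:
  assumes k: "k > 1 / 2" and w: "0 < w" "w \<le> 1 / 2"
    and \<rho>: "0 < \<rho>" "\<rho> < \<xi>" and \<xi>: "1 / 2 \<le> \<xi>" "\<xi> \<le> 1"
    and eq: "\<xi>\<^sup>2 + 2 * \<xi> * \<rho> * (1 - w) + \<rho>\<^sup>2 = 1"
  shows "reflected_mean \<xi> \<rho> (kink k) \<theta> \<le>
    \<rho> ^ 3 * (16 * k * (2 * k - 1) * (2 * k + 1) * cap w \<theta> ^ 3
      - (2 * k - 1) / 64 * ((1 - cos \<theta>) * cap w \<theta>))"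
proof -
  define z where "z = chord \<xi> \<rho> \<theta>"
  define s where "s = chord_cos \<xi> \<rho> \<theta>"
  define v where "v = 1 - cos \<theta>"
  define y where "y = cap w \<theta>"
  have \<rho>': "\<rho> < \<bar>\<xi>\<bar>" using \<rho> \<xi> by simp
  note facts = chord_facts[OF \<rho>(1) \<rho>', of \<theta>, folded z_def s_def]
  have z: "0 < z" "z \<le> 2" and s: "-1 \<le> s" "s \<le> 1"
    using facts \<rho> \<xi> by auto
  have z2: "z\<^sup>2 = 1 + 2 * \<xi> * \<rho> * (w - v)"
    using facts(3) eq \<xi> by (simp add: chord_sq_def v_def algebra_simps)
  have v: "0 \<le> v" by (simp add: v_def)
  show ?thesis
  proof (cases "v < w")
    case False
    then have "\<xi> * \<rho> * (w - v) \<le> 0"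
      using \<xi> \<rho> by (intro mult_nonneg_nonpos) auto
    moreover have "z\<^sup>2 = 1 + 2 * (\<xi> * \<rho> * (w - v))"
      by (simp add: z2)
    ultimately have "z\<^sup>2 \<le> 1\<^sup>2"
      unfolding one_power2 by linarith
    then have "z \<le> 1"
      using power2_le_imp_le[of z 1] by simp
    moreover have "cap w \<theta> = 0"
      using False by (simp add: cap_def v_def)
    ultimately show ?thesis
      using z kink_zero(1)[of z k] kink_zero(1)[of "- z" k]
      by (simp add: reflected_mean_def z_def)
  next
    case True
    then have y: "y = w - v" "0 < y"
      by (auto simp: y_def cap_def v_def)
    have z2': "z\<^sup>2 - 1 = 2 * \<xi> * \<rho> * y"
      using z2 y by simp
    have "2 * \<xi> * \<rho> * y > 0" using \<xi> \<rho> y by simp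
    then have "\<not> z\<^sup>2 \<le> 1"
      using z2' by linarith
    then have z1: "z > 1"
      using z power_mono[of z 1 2] by fastforce
    have fac: "z\<^sup>2 - 1 = (z - 1) * (z + 1)"
      by (simp add: algebra_simps power2_eq_square)
    have up: "z - 1 \<le> 2 * \<rho> * y"
    proof -
      have "(z - 1) * 1 \<le> (z - 1) * (z + 1)"
        using z1 by (intro mult_left_mono) auto
      moreover have "\<xi> * (2 * \<rho> * y) \<le> 1 * (2 * \<rho> * y)"
        using \<xi> \<rho> y by (intro mult_right_mono) auto
      ultimately show ?thesis
        using fac z2' by (simp add: algebra_simps)
    qed
    have low: "\<rho> * y / 4 \<le> z - 1"
    proof -
      have "(z - 1) * (z + 1) \<le> (z - 1) * 4"
        using z1 z by (intro mult_left_mono) auto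
      moreover have "1 / 2 * (2 * \<rho> * y) \<le> \<xi> * (2 * \<rho> * y)"
        using \<xi> \<rho> y by (intro mult_right_mono) auto
      ultimately show ?thesis
        using fac z2' by (simp add: algebra_simps)
    qed
    \<comment> \<open>The probability of reflection, from \<open>1 - s\<^sup>2 = (\<rho> sin \<theta> / z)\<^sup>2\<close>.\<close>
    have s_low: "\<rho>\<^sup>2 * v / 8 \<le> 1 - s"
    proof -
      have sz: "s * z = \<xi> + \<rho> * cos \<theta>"
      proof -
        have "z\<^sup>2 + \<xi>\<^sup>2 - \<rho>\<^sup>2 = 2 * \<xi> * (\<xi> + \<rho> * cos \<theta>)"
          using facts(3) \<xi> by (simp add: chord_sq_def algebra_simps power2_eq_square)
        then show ?thesis
          using facts(3) z \<xi> by (simp add: s_def chord_cos_def z_def[symmetric])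
      qed
      have "(1 - s) * (1 + s) * z\<^sup>2 = z\<^sup>2 - (s * z)\<^sup>2"
        by (simp add: algebra_simps power2_eq_square)
      also have "\<dots> = \<rho>\<^sup>2 * (1 - (cos \<theta>)\<^sup>2)"
        unfolding sz facts(3) using \<xi> by (simp add: chord_sq_def algebra_simps power2_eq_square)
      also have "\<dots> = \<rho>\<^sup>2 * (v * (2 - v))"
        by (simp add: v_def algebra_simps power2_eq_square)
      finally have "(1 - s) * (1 + s) * z\<^sup>2 = \<rho>\<^sup>2 * (v * (2 - v))" .
      moreover have "(1 - s) * ((1 + s) * z\<^sup>2) \<le> (1 - s) * (2 * 4)"
      proof -
        have "z\<^sup>2 \<le> 2\<^sup>2" using z by (intro power_mono) auto
        then show ?thesis using s by (intro mult_left_mono mult_mono) auto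
      qed
      moreover have "\<rho>\<^sup>2 * (v * 1) \<le> \<rho>\<^sup>2 * (v * (2 - v))"
        using v True w by (intro mult_left_mono) auto
      ultimately show ?thesis by (simp add: mult.assoc)
    qed
    define L where "L = 2 * k * (2 * k - 1) * (2 * k + 1)"
    have L: "L \<ge> 0" using k by (simp add: L_def)
    have kz: "kink k z = outer_branch k 1 z" "kink k (- z) = outer_branch k (- 1) z"
      using z1 outer_branch_at_1 by (auto simp: kink_def)
    have "outer_branch k 1 z \<le> 8 * L * (\<rho> * y) ^ 3"
    proof -
      have "outer_branch k 1 z \<le> L * (z - 1) ^ 3"
        using outer_branch_cubic_bound[OF k, of z] z1 by (simp add: L_def)
      also have "\<dots> \<le> L * (2 * \<rho> * y) ^ 3"
        using L up z1 by (intro mult_left_mono power_mono) auto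
      finally show ?thesis by (simp add: power_mult_distrib mult_ac)
    qed
    then have "(1 + s) / 2 * outer_branch k 1 z \<le> (1 + s) / 2 * (8 * L * (\<rho> * y) ^ 3)"
      using s by (intro mult_left_mono) auto
    moreover have "(1 + s) / 2 * (8 * L * (\<rho> * y) ^ 3) \<le> 1 * (8 * L * (\<rho> * y) ^ 3)"
      using s L \<rho> y by (intro mult_right_mono) auto
    moreover have "(1 - s) / 2 * outer_branch k (- 1) z \<le> - ((2 * k - 1) / 64 * (v * y) * \<rho> ^ 3)"
    proof -
      have "(\<rho>\<^sup>2 * v / 8) * (\<rho> * y / 4) \<le> (1 - s) * (z - 1)"
        using s_low low \<rho> v y s by (intro mult_mono) auto
      then have "(2 * k - 1) * ((\<rho>\<^sup>2 * v / 8) * (\<rho> * y / 4)) \<le> (2 * k - 1) * ((1 - s) * (z - 1))"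
        using k by (intro mult_left_mono) auto
      moreover have "(1 - s) * outer_branch k (- 1) z \<le> (1 - s) * (- (2 * k - 1) * (z - 1))"
        using outer_branch_reflected_bound[OF k, of z] z1 s by (intro mult_left_mono) auto
      moreover have "(2 * k - 1) * ((\<rho>\<^sup>2 * v / 8) * (\<rho> * y / 4)) = 2 * ((2 * k - 1) / 64 * (v * y) * \<rho> ^ 3)"
        by (simp add: power2_eq_square power3_eq_cube)
      moreover have "(1 - s) * (- (2 * k - 1) * (z - 1)) = - ((2 * k - 1) * ((1 - s) * (z - 1)))"
        by (simp add: algebra_simps)
      moreover have "(1 - s) / 2 * outer_branch k (- 1) z = (1 - s) * outer_branch k (- 1) z / 2"
        by simp
      ultimately show ?thesis
        by linarith
    qed
    ultimately have "(1 + s) / 2 * kink k z + (1 - s) / 2 * kink k (- z)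
        \<le> 8 * L * (\<rho> * y) ^ 3 - (2 * k - 1) / 64 * (v * y) * \<rho> ^ 3"
      unfolding kz by linarith
    moreover have "reflected_mean \<xi> \<rho> (kink k) \<theta> = (1 + s) / 2 * kink k z + (1 - s) / 2 * kink k (- z)"
      by (simp add: reflected_mean_def z_def s_def add_divide_distrib)
    moreover have "8 * L * (\<rho> * y) ^ 3 - (2 * k - 1) / 64 * (v * y) * \<rho> ^ 3
        = \<rho> ^ 3 * (16 * k * (2 * k - 1) * (2 * k + 1) * y ^ 3 - (2 * k - 1) / 64 * (v * y))"
      by (simp add: L_def power_mult_distrib right_diff_distrib mult_ac)
    ultimately show ?thesis
      by (simp only: y_def v_def)
  qed
qed

text \<open>
  First fix a cap so small that the reflected part wins, then choose the centre \<open>\<xi>\<close> such that the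
  part of the chord beyond \<open>1\<close> is this cap. The choice of \<open>w\<close> depends only on \<open>k\<close>, hence arbitrarily small radii
  are allowed.
\<close>

lemma reflected_mean_kink_negative:
  assumes k: "k > 1 / 2" and \<rho>: "0 < \<rho>" "\<rho> \<le> 1 / 8"
  obtains \<xi> where "1 - 2 * \<rho> \<le> \<xi>" "\<xi> < 1"
    "integral {0..pi} (\<lambda>\<theta>. reflected_mean \<xi> \<rho> (kink k) \<theta> * angle_weight k \<theta>) < 0"
proof -
  \<comment> \<open>Any constant above \<open>96 * 64\<close> would do; see the last estimate.\<close>
  define w where "w = 1 / (7000 * (2 * k + 1))"
  have w: "0 < w" "w \<le> 1 / 2" and w_eq: "(2 * k + 1) * w = 1 / 7000"
    using k by (auto simp: w_def field_simps)
  \<comment> \<open>The positive root of the equation below, which says that \<open>chord \<xi> \<rho> \<theta> = 1\<close> for \<open>cos \<theta> = 1 - w\<close>.\<close>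
  define \<xi> where "\<xi> = sqrt (1 - \<rho>\<^sup>2 * (1 - (1 - w)\<^sup>2)) - \<rho> * (1 - w)"
  have c: "0 \<le> 1 - (1 - w)\<^sup>2" "1 - (1 - w)\<^sup>2 \<le> 1"
    using w by (auto simp: abs_square_le_1)
  have \<rho>2: "\<rho>\<^sup>2 \<le> \<rho>"
    using \<rho> by (simp add: power2_eq_square mult_left_le)
  have r: "0 \<le> \<rho>\<^sup>2 * (1 - (1 - w)\<^sup>2)" "\<rho>\<^sup>2 * (1 - (1 - w)\<^sup>2) \<le> \<rho>\<^sup>2"
    using c mult_left_mono[OF c(2), of "\<rho>\<^sup>2"] by auto
  have \<xi>1: "\<xi> < 1"
  proof -
    have "sqrt (1 - \<rho>\<^sup>2 * (1 - (1 - w)\<^sup>2)) \<le> 1" using r by simp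
    moreover have "\<rho> * (1 - w) > 0" using \<rho> w by simp
    ultimately show ?thesis unfolding \<xi>_def by linarith
  qed
  have \<xi>0: "1 - 2 * \<rho> \<le> \<xi>"
  proof -
    have "(1 - \<rho>)\<^sup>2 \<le> 1 - \<rho>\<^sup>2 * (1 - (1 - w)\<^sup>2)"
      using r \<rho>2 by (simp add: power2_diff)
    then have "1 - \<rho> \<le> sqrt (1 - \<rho>\<^sup>2 * (1 - (1 - w)\<^sup>2))"
      using real_le_rsqrt by blast
    moreover have "\<rho> * (1 - w) \<le> \<rho> * 1" using \<rho> w by (intro mult_left_mono) auto
    ultimately show ?thesis by (simp add: \<xi>_def)
  qed
  have eq: "\<xi>\<^sup>2 + 2 * \<xi> * \<rho> * (1 - w) + \<rho>\<^sup>2 = 1"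
  proof -
    have "(\<xi> + \<rho> * (1 - w))\<^sup>2 = 1 - \<rho>\<^sup>2 * (1 - (1 - w)\<^sup>2)"
      using order_trans[OF r(2) \<rho>2] \<rho> by (simp add: \<xi>_def)
    moreover have "(\<xi> + \<rho> * (1 - w))\<^sup>2 = \<xi>\<^sup>2 + 2 * \<xi> * \<rho> * (1 - w) + \<rho>\<^sup>2 * (1 - w)\<^sup>2"
      by (simp add: power2_sum power_mult_distrib)
    moreover have "\<rho>\<^sup>2 * (1 - (1 - w)\<^sup>2) = \<rho>\<^sup>2 - \<rho>\<^sup>2 * (1 - w)\<^sup>2"
      by (simp add: right_diff_distrib)
    ultimately show ?thesis by linarith
  qed
  have \<rho>\<xi>: "\<rho> < \<xi>" "1 / 2 \<le> \<xi>" using \<xi>0 \<rho> by auto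
  let ?W = "angle_weight k"
  define A where "A = integral {0..pi} (\<lambda>\<theta>. cap w \<theta> ^ 3 * ?W \<theta>)"
  define J where "J = integral {0..pi} (\<lambda>\<theta>. (1 - cos \<theta>) * cap w \<theta> * ?W \<theta>)"
  define C where "C = 16 * k * (2 * k - 1) * (2 * k + 1)"
  have J: "J > 0" using cap_integral_pos[OF k w] by (simp add: J_def)
  have A: "k * A \<le> 6 * w * J" using cap_cubed_integral_le[OF k w] by (simp add: J_def A_def)
  have upper: "((\<lambda>\<theta>. \<rho> ^ 3 * (C * (cap w \<theta> ^ 3 * ?W \<theta>)
      - (2 * k - 1) / 64 * ((1 - cos \<theta>) * cap w \<theta> * ?W \<theta>))) has_integral
      \<rho> ^ 3 * (C * A - (2 * k - 1) / 64 * J)) {0..pi}"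
    unfolding A_def J_def
    by (intro has_integral_diff has_integral_mult_right integrable_integral angle_weight_integrable k
        continuous_intros continuous_on_cap)
  have mean: "((\<lambda>\<theta>. reflected_mean \<xi> \<rho> (kink k) \<theta> * ?W \<theta>) has_integral
      integral {0..pi} (\<lambda>\<theta>. reflected_mean \<xi> \<rho> (kink k) \<theta> * ?W \<theta>)) {0..pi}"
    using \<rho> \<rho>\<xi> by (intro integrable_integral integrable_reflected_mean k continuous_on_kink) auto
  have "integral {0..pi} (\<lambda>\<theta>. reflected_mean \<xi> \<rho> (kink k) \<theta> * ?W \<theta>)
      \<le> \<rho> ^ 3 * (C * A - (2 * k - 1) / 64 * J)"
  proof (rule has_integral_le[OF mean upper])
    fix \<theta> :: real
    show "reflected_mean \<xi> \<rho> (kink k) \<theta> * ?W \<theta> \<le> \<rho> ^ 3 * (C * (cap w \<theta> ^ 3 * ?W \<theta>)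
      - (2 * k - 1) / 64 * ((1 - cos \<theta>) * cap w \<theta> * ?W \<theta>))"
    proof -
      have "\<rho> ^ 3 * (C * a - q * b) * u = \<rho> ^ 3 * (C * (a * u) - q * (b * u))" for a b q u
        by (simp add: algebra_simps)
      then show ?thesis
        using mult_right_mono[OF reflected_mean_kink_le[OF k w \<rho>(1) \<rho>\<xi> less_imp_le[OF \<xi>1] eq, of \<theta>]
            angle_weight_nonneg[of k \<theta>]]
        by (simp only: C_def[symmetric])
    qed
  qed
  also have "\<dots> < 0"
  proof -
    have "16 * (2 * k - 1) * (2 * k + 1) * (k * A) \<le> 16 * (2 * k - 1) * (2 * k + 1) * (6 * w * J)"
      using A k by (intro mult_left_mono) auto
    also have "\<dots> = 96 * (2 * k - 1) * ((2 * k + 1) * w) * J"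
      by (simp add: algebra_simps)
    also have "\<dots> = 96 / 7000 * ((2 * k - 1) * J)"
      unfolding w_eq by simp
    also have "\<dots> < 1 / 64 * ((2 * k - 1) * J)"
      using k J by (intro mult_strict_right_mono) auto
    finally have "C * A - (2 * k - 1) / 64 * J < 0"
      by (simp add: C_def mult_ac)
    then show ?thesis
      using \<rho> by (simp add: mult_pos_neg)
  qed
  finally show ?thesis
    using that \<xi>0 \<xi>1 by blast
qed

lemma reflected_mean_scale:
  assumes c: "c \<noteq> 0" and \<xi>: "\<xi> > 0"
  shows "reflected_mean (c * \<xi>) (\<bar>c\<bar> * \<rho>) (\<lambda>y. f (y / c)) \<theta> = reflected_mean \<xi> \<rho> f \<theta>"
proof -
  have sq: "chord_sq (c * \<xi>) (\<bar>c\<bar> * \<rho>) \<theta> = c\<^sup>2 * chord_sq \<xi> \<rho> \<theta>"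
    using c by (simp add: chord_sq_def abs_mult algebra_simps power_mult_distrib)
      (simp add: power2_eq_square)
  then have z: "chord (c * \<xi>) (\<bar>c\<bar> * \<rho>) \<theta> = \<bar>c\<bar> * chord \<xi> \<rho> \<theta>"
    by (simp add: chord_def real_sqrt_mult)
  have "chord_cos (c * \<xi>) (\<bar>c\<bar> * \<rho>) \<theta>
      = (c\<^sup>2 * (chord_sq \<xi> \<rho> \<theta> + \<xi>\<^sup>2 - \<rho>\<^sup>2)) / ((c * \<bar>c\<bar>) * (2 * \<xi> * chord \<xi> \<rho> \<theta>))"
    unfolding chord_cos_def sq z by (simp add: power_mult_distrib algebra_simps)
  also have "\<dots> = sgn c * chord_cos \<xi> \<rho> \<theta>"
    using c by (cases "c > 0") (auto simp: chord_cos_def power2_eq_square minus_divide_left)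
  finally have s: "chord_cos (c * \<xi>) (\<bar>c\<bar> * \<rho>) \<theta> = sgn c * chord_cos \<xi> \<rho> \<theta>" .
  show ?thesis
    unfolding reflected_mean_def z s using c by (cases "c > 0") auto
qed

section \<open>Failure of the mean value property\<close>

theorem proposition3p5:
  fixes k :: real
    and V :: "(real \<Rightarrow> real) \<Rightarrow> (real \<Rightarrow> real)"
    and \<mu> :: "real \<Rightarrow> real measure"
    and \<sigma> :: "real \<Rightarrow> real \<Rightarrow> real measure"
    and U :: "real set"
  assumes "k \<ge> 0" and "k - 1 / 2 > 0"
    and "intertwining_operator k V"
    and "representing_measures V \<mu>"
    and "\<And>x r. r > 0 \<Longrightarrow> dunkl_sphere_measure k V \<mu> x r (\<sigma> x r)"
    and "open U" and "uminus ` U \<noteq> U"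
  shows "\<exists>h :: real \<Rightarrow> real. h \<in> borel_measurable borel \<and> dunkl_harmonic_on k h U \<and>
           (\<forall>x\<in>U. \<forall>r>0. {x - r..x + r} \<subseteq> U \<longrightarrow> integrable (\<sigma> x r) h) \<and>
           \<not> mean_value_property_on \<sigma> h U"
proof -
  have k: "k > 1 / 2" using assms(2) by simp
  \<comment> \<open>Whichever of \<open>U\<close> and \<open>-U\<close> fails to contain the other, \<open>U\<close> has a point whose mirror image is missing.\<close>
  obtain c where c: "c \<in> U" "- c \<notin> U"
  proof (cases "U \<subseteq> uminus ` U")
    case True
    then obtain c where "c \<in> U" "- c \<notin> U" using assms(7) by auto
    then show ?thesis by (rule that)
  next
    case False
    then obtain c where "c \<in> U" "c \<notin> uminus ` U" by blast
    then have "- c \<notin> U" using image_eqI[of c uminus "- c" U] by auto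
    then show ?thesis using \<open>c \<in> U\<close> by (rule that[rotated])
  qed
  then have c0: "c \<noteq> 0" by auto
  define h where "h = (\<lambda>y. kink k (y / c))"
  have cont: "continuous_on UNIV h"
    unfolding h_def using c0 by (intro continuous_on_compose2[OF continuous_on_kink] continuous_intros) auto
  have "dunkl_harmonic_on k h U"
  proof -
    have "U \<subseteq> - {- c}" using c by auto
    with dunkl_harmonic_kink[OF c0, of k, folded h_def] show ?thesis
      unfolding dunkl_harmonic_on_def C2_on_def using continuous_on_subset by blast
  qed
  moreover have "integrable (\<sigma> x r) h" if "r > 0" for x r
    by (rule integrable_continuous_compact_support[OF dunkl_sphere_support[OF assms(5)[OF that] that] cont])
  moreover have "h \<in> borel_measurable borel"
    using cont by (rule borel_measurable_continuous_onI)
  moreover have "\<not> mean_value_property_on \<sigma> h U"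
  proof
    assume mvp: "mean_value_property_on \<sigma> h U"
    obtain e where e: "e > 0" "ball c e \<subseteq> U"
      using assms(6) c(1) open_contains_ball by blast
    \<comment> \<open>The interval used below lies within distance \<open>3 \<bar>c\<bar> \<rho>\<close> of \<open>c\<close>.\<close>
    define \<rho> where "\<rho> = min (1 / 8) (e / (4 * \<bar>c\<bar>))"
    have \<rho>: "0 < \<rho>" "\<rho> \<le> 1 / 8" "4 * \<bar>c\<bar> * \<rho> \<le> e"
      using e c0 by (auto simp: \<rho>_def min_def field_simps)
    obtain \<xi> where \<xi>: "1 - 2 * \<rho> \<le> \<xi>" "\<xi> < 1"
      and neg: "integral {0..pi} (\<lambda>\<theta>. reflected_mean \<xi> \<rho> (kink k) \<theta> * angle_weight k \<theta>) < 0"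
      using reflected_mean_kink_negative[OF k \<rho>(1,2)] by blast
    define x where "x = c * \<xi>"
    define r where "r = \<bar>c\<bar> * \<rho>"
    have r: "r > 0" "r < \<bar>x\<bar>"
      using c0 \<rho> \<xi> by (auto simp: r_def x_def abs_mult)
    have sub: "{x - r..x + r} \<subseteq> U"
    proof
      fix y assume y: "y \<in> {x - r..x + r}"
      have "c - x = c * (1 - \<xi>)"
        by (simp add: x_def algebra_simps)
      then have "\<bar>c - x\<bar> = \<bar>c\<bar> * (1 - \<xi>)"
        using \<xi> by (simp add: abs_mult)
      also have "\<dots> \<le> \<bar>c\<bar> * (2 * \<rho>)"
        using \<xi> by (intro mult_left_mono) auto
      finally have "\<bar>c - y\<bar> \<le> 3 * (\<bar>c\<bar> * \<rho>)"
        using y by (auto simp: r_def)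
      also have "\<dots> < e"
        using \<rho> r by (simp add: r_def)
      finally show "y \<in> U"
        using e by (auto simp: dist_real_def)
    qed
    moreover have "x \<in> U" using sub r by auto
    ultimately have "(LINT y|\<sigma> x r. h y) = h x"
      using mvp r by (auto simp: mean_value_property_on_def)
    also have "\<dots> = 0"
      using c0 \<xi> \<rho> kink_zero(1)[of \<xi> k] by (simp add: h_def x_def)
    finally have "integral {0..pi} (\<lambda>\<theta>. reflected_mean x r h \<theta> * angle_weight k \<theta>) = 0"
      using dunkl_sphere_integral[OF k assms(3,4) assms(5)[OF r(1)] r cont] by simp
    moreover have "reflected_mean x r h \<theta> = reflected_mean \<xi> \<rho> (kink k) \<theta>" for \<theta>
      unfolding x_def r_def h_def using c0 \<xi> \<rho> by (intro reflected_mean_scale) auto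
    ultimately show False using neg by simp
  qed
  ultimately show ?thesis by blast
qed

end
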